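(* There exists $\lambda_0>0$ such that the following holds. Fix $\lambda\in(0,\lambda_0]$, assume that $\lambda V^{1/2}>1$ (where $V=2^N$), and let $z_N=z_N(\lambda)$ and $\beta=N^{-1}+\lambda^2$. For all $z\in[0,z_N]$, $$\frac{1}{\lambda^{-1}V^{-1/2}+1-z/z_N}\;\le\;\chi_N(z)\;\le\;\frac{2-z/z_N}{\lambda^{-1}V^{-1/2}+(1-O(\beta))(1-z/z_N)} ,$$ where $O(\beta)$ denotes a quantity bounded in absolute value by $C\beta$ with a constant $C$ independent of $N$, $z$ and $\lambda\in(0,\lambda_0]$.
   Context: For a positive integer $N$, $\mathbb{Q}^N=\mathbb{Z}_2^N$ is the $N$-dimensional hypercube (binary strings of length $N$, with coordinatewise addition mod 2), $V=V(N)=2^N$, and $|x|$ is the number of coordinates of $x\in\mathbb{Q}^N$ equal to 1. An $n$-step self-avoiding walk is a function $\omega:\{0,\dots,n\}\to\mathbb{Q}^N$ with $|\omega(i)-\omega(i-1)|=1$ for $1\le i\le n$ and $\omega(i)\ne\omega(j)$ for $i\neq j$. $c_n^{(N)}$ is the number of $n$-step self-avoiding walks with $\omega(0)=0$, with $c_0^{(N)}=1$. The susceptibility is the polynomial $\chi_N(z)=\sum_{n=0}^{V-1}c_n^{(N)}z^n$. For $\lambda>0$ with $\lambda V^{1/2}>1$, the critical value $z_N=z_N(\lambda)>0$ is the unique positive solution of $\chi_N(z_N)=\lambda V^{1/2}$. *)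

theory Defs
  imports "HOL-Analysis.Analysis" "HOL-Library.Z2"
begin

text \<open>
  The dimension \<open>N\<close> is quantified inside the theorem, so it cannot be a type: points of
  the hypercube are maps \<open>nat \<Rightarrow> bit\<close> vanishing from index \<open>N\<close> on, where \<open>bit\<close> is the
  two-element field.
\<close>

definition hypercube :: "nat \<Rightarrow> (nat \<Rightarrow> bit) set" where
  "hypercube N = {x. \<forall>i\<ge>N. x i = 0}"

definition hweight :: "nat \<Rightarrow> (nat \<Rightarrow> bit) \<Rightarrow> nat" where
  "hweight N x = card {i. i < N \<and> x i = 1}"

definition vol :: "nat \<Rightarrow> nat" where
  "vol N = 2 ^ N"

text \<open>
  Walks are extensional on \<open>{0..n}\<close>, so that each function on \<open>{0..n}\<close> is counted once.
\<close>

definition self_avoiding_walks :: "nat \<Rightarrow> nat \<Rightarrow> (nat \<Rightarrow> nat \<Rightarrow> bit) set" where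
  "self_avoiding_walks N n =
    {\<omega> \<in> {0..n} \<rightarrow>\<^sub>E hypercube N.
       (\<forall>i\<in>{1..n}. hweight N (\<lambda>k. \<omega> i k - \<omega> (i - 1) k) = 1) \<and> inj_on \<omega> {0..n}}"

definition saw_count :: "nat \<Rightarrow> nat \<Rightarrow> nat" where
  "saw_count N n = card {\<omega> \<in> self_avoiding_walks N n. \<omega> 0 = (\<lambda>k. 0)}"

definition susceptibility :: "nat \<Rightarrow> real \<Rightarrow> real" where
  "susceptibility N z = (\<Sum>n=0..vol N - 1. real (saw_count N n) * z ^ n)"

text \<open>
  Meaningful for \<open>N \<ge> 1\<close> and \<open>lam * V powr (1 / 2) > 1\<close>; see \<open>critical_value_ex1\<close> below.
\<close>

definition critical_value :: "nat \<Rightarrow> real \<Rightarrow> real" where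
  "critical_value N lam =
    (THE z. z > 0 \<and> susceptibility N z = lam * real (vol N) powr (1 / 2))"

lemma finite_hypercube: "finite (hypercube N)"
proof -
  have "hypercube N \<subseteq> (\<lambda>S i. if i \<in> S then 1 else 0) ` Pow {..<N}"
  proof
    fix x assume x: "x \<in> hypercube N"
    have "x = (\<lambda>i. if i \<in> {i. i < N \<and> x i = 1} then 1 else 0)"
    proof
      fix i
      show "x i = (if i \<in> {i. i < N \<and> x i = 1} then 1 else 0)"
        using x by (cases "x i") (auto simp: hypercube_def not_less)
    qed
    then show "x \<in> (\<lambda>S i. if i \<in> S then 1 else 0) ` Pow {..<N}"
      by (intro image_eqI[where x = "{i. i < N \<and> x i = 1}"]) auto
  qed
  then show ?thesis by (rule finite_subset) auto
qed

lemma finite_self_avoiding_walks: "finite (self_avoiding_walks N n)"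
  unfolding self_avoiding_walks_def
  by (rule finite_subset[OF _ finite_PiE[of "{0..n}" "\<lambda>_. hypercube N"]])
     (auto simp: finite_hypercube)

lemma saw_count_0: "saw_count N 0 = 1"
proof -
  have "{\<omega> \<in> self_avoiding_walks N 0. \<omega> 0 = (\<lambda>k. 0)} =
        {(\<lambda>i\<in>{0}. (\<lambda>k. 0))}"
    by (auto simp: self_avoiding_walks_def hypercube_def PiE_def extensional_def fun_eq_iff)
  then show ?thesis by (simp add: saw_count_def)
qed

lemma saw_count_1_pos:
  assumes "N \<ge> 1"
  shows "saw_count N 1 > 0"
proof -
  let ?\<omega> = "\<lambda>i\<in>{0..1::nat}. \<lambda>k::nat. if i = 1 \<and> k = 0 then 1 else (0::bit)"
  have "{k. k < N \<and> ?\<omega> 1 k - ?\<omega> 0 k = 1} = {0}"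
    using assms by (auto split: if_splits)
  then have "hweight N (\<lambda>k. ?\<omega> 1 k - ?\<omega> 0 k) = 1"
    by (simp add: hweight_def)
  moreover have "inj_on ?\<omega> {0..1}"
    by (auto simp: inj_on_def fun_eq_iff le_Suc_eq split: if_splits)
  moreover have "?\<omega> \<in> {0..1} \<rightarrow>\<^sub>E hypercube N"
    using assms by (auto simp: hypercube_def PiE_def extensional_def)
  moreover have "{1..1} = {1::nat}" by simp
  ultimately have "?\<omega> \<in> {\<omega> \<in> self_avoiding_walks N 1. \<omega> 0 = (\<lambda>k. 0)}"
    unfolding self_avoiding_walks_def by auto
  then show ?thesis
    unfolding saw_count_def using finite_self_avoiding_walks[of N 1]
    by (subst card_gt_0_iff) auto
qed

lemma susceptibility_0: "susceptibility N 0 = 1"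
  by (simp add: susceptibility_def power_0_left if_distrib saw_count_0 cong: if_cong)

lemma susceptibility_strict_mono:
  assumes "N \<ge> 1" "0 \<le> x" "x < y"
  shows "susceptibility N x < susceptibility N y"
  unfolding susceptibility_def
proof (rule sum_strict_mono_ex1)
  show "\<forall>n\<in>{0..vol N - 1}. real (saw_count N n) * x ^ n \<le> real (saw_count N n) * y ^ n"
    using assms by (auto intro!: mult_left_mono power_mono)
  have "(2::nat) ^ 1 \<le> 2 ^ N" using assms(1) by (intro power_increasing) auto
  then have "1 \<in> {0..vol N - 1}" by (simp add: vol_def)
  then show "\<exists>n\<in>{0..vol N - 1}. real (saw_count N n) * x ^ n < real (saw_count N n) * y ^ n"
    using saw_count_1_pos[OF assms(1)] assms(3) by (intro bexI[of _ 1]) auto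
qed auto

lemma susceptibility_ge:
  assumes "N \<ge> 1" "0 \<le> z"
  shows "z \<le> susceptibility N z"
proof -
  have "(2::nat) ^ 1 \<le> 2 ^ N" using assms(1) by (intro power_increasing) auto
  then have 1: "1 \<in> {0..vol N - 1}" by (simp add: vol_def)
  have "z \<le> real (saw_count N 1) * z ^ 1"
    using saw_count_1_pos[OF assms(1)] assms(2) mult_right_mono[of 1 "real (saw_count N 1)" z]
    by simp
  also have "\<dots> \<le> susceptibility N z"
    unfolding susceptibility_def
    using 1 assms(2)
    by (intro member_le_sum[where f = "\<lambda>n. real (saw_count N n) * z ^ n"]) auto
  finally show ?thesis .
qed

lemma critical_value_ex1:
  assumes "N \<ge> 1" "lam * real (vol N) powr (1 / 2) > 1"
  shows "\<exists>!z. z > 0 \<and> susceptibility N z = lam * real (vol N) powr (1 / 2)"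
proof -
  define L where "L = lam * real (vol N) powr (1 / 2)"
  have L: "L > 1" using assms(2) by (simp add: L_def)
  have "continuous_on {0..L} (susceptibility N)"
    unfolding susceptibility_def by (intro continuous_intros)
  then obtain z where z: "0 \<le> z" "susceptibility N z = L"
    using IVT'[of "susceptibility N" 0 L L] susceptibility_0[of N]
      susceptibility_ge[OF assms(1), of L] L by auto
  have "z > 0" using z L susceptibility_0[of N] by (cases "z = 0") auto
  moreover have "w = z" if "w > 0" "susceptibility N w = L" for w
    using susceptibility_strict_mono[OF assms(1), of w z]
      susceptibility_strict_mono[OF assms(1), of z w] that z
    by (cases w z rule: linorder_cases) auto
  ultimately show ?thesis using z unfolding L_def by blast
qed

end

theory Submission
  imports Defs "HOL-Real_Asymp.Real_Asymp"
begin

text \<open>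
  Cutting a walk at a vertex gives two walks that do not meet again, so \<open>(z \<chi>)' \<le> \<chi>\<^sup>2\<close>;
  subtracting the pairs that do meet again gives \<open>(z \<chi>)' \<ge> (1 - B) \<chi>\<^sup>2\<close>, where \<open>B\<close> is the sum of \<open>G(0, x)\<^sup>2\<close> over \<open>x \<noteq> 0\<close> and \<open>G\<close> is the
  two-point function. Integrating \<open>1 / (z \<chi>)\<close> up to \<open>z\<^sub>N\<close> proves the theorem once
  \<open>B = O(1 / N + \<chi>\<^sup>2 / V)\<close>.

  No lace expansion is needed for this bubble bound, because on the hypercube simple random walk
  mixes in about \<open>N log N\<close> steps. Forbidding immediate reversals yields the pointwise inequality
  \<open>G \<le> \<delta> + s A G\<close>, where \<open>A\<close> is the adjacency operator and
  \<open>s = z (1 + z g) / (1 + N z\<^sup>2)\<close>, \<open>g\<close> being an upper bound for \<open>G\<close> at the neighbours of the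
  origin. The first-step decomposition of \<open>\<chi>\<close> shows \<open>s N \<le> 1 + O(1 / N\<^sup>2)\<close>, so the inequality can be
  iterated of order \<open>N\<^sup>2\<close> times at bounded cost; after that many steps the random walk is uniform and
  the remainder is \<open>O(\<chi> / V)\<close>, while the terms of the iteration are moments of the normalised sum
  of \<open>N\<close> random signs. The value of \<open>G\<close> at the neighbours, on which \<open>s\<close> depends, is controlled by
  a continuity argument in \<open>z\<close>.
\<close>

section \<open>Self-avoiding walks as vertex lists\<close>

definition flip :: "nat \<Rightarrow> (nat \<Rightarrow> bit) \<Rightarrow> nat \<Rightarrow> bit" where
  "flip i x = x(i := x i + 1)"

definition shift :: "(nat \<Rightarrow> bit) \<Rightarrow> (nat \<Rightarrow> bit) \<Rightarrow> nat \<Rightarrow> bit" where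
  "shift a x = (\<lambda>k. a k + x k)"

definition adj :: "nat \<Rightarrow> (nat \<Rightarrow> bit) \<Rightarrow> (nat \<Rightarrow> bit) \<Rightarrow> bool" where
  "adj N x y \<longleftrightarrow> (\<exists>i<N. y = flip i x)"

definition saw :: "nat \<Rightarrow> (nat \<Rightarrow> bit) list \<Rightarrow> bool" where
  "saw N xs \<longleftrightarrow> xs \<noteq> [] \<and> distinct xs \<and> set xs \<subseteq> hypercube N \<and> successively (adj N) xs"

text \<open>The set \<open>L\<close> of admissible endpoints lets the same lemmas serve the
  two-point function (\<open>L = {y}\<close>) and the susceptibility
  (\<open>L = UNIV\<close>).\<close>

definition saws :: "nat \<Rightarrow> (nat \<Rightarrow> bit) set \<Rightarrow> (nat \<Rightarrow> bit) \<Rightarrow> (nat \<Rightarrow> bit) list set" where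
  "saws N L x = {xs. saw N xs \<and> hd xs = x \<and> last xs \<in> L}"

text \<open>A list of \<open>n + 1\<close> vertices is a walk of \<open>n\<close> steps; on nonempty
  lists the subtraction is never truncated.\<close>

definition weight :: "real \<Rightarrow> 'a list \<Rightarrow> real" where
  "weight z xs = z ^ (length xs - 1)"

definition gf :: "nat \<Rightarrow> real \<Rightarrow> (nat \<Rightarrow> bit) set \<Rightarrow> (nat \<Rightarrow> bit) \<Rightarrow> real" where
  "gf N z L x = (\<Sum>xs\<in>saws N L x. weight z xs)"

abbreviation two_point :: "nat \<Rightarrow> real \<Rightarrow> (nat \<Rightarrow> bit) \<Rightarrow> (nat \<Rightarrow> bit) \<Rightarrow> real" where
  "two_point N z x y \<equiv> gf N z {y} x"

abbreviation origin :: "nat \<Rightarrow> bit" where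
  "origin \<equiv> (\<lambda>_. 0)"

lemma bit_add_self [simp]: "(a::bit) + a = 0" "(a::bit) + (a + b) = b"
  by (cases a; cases b; simp)+

lemma flip_flip [simp]: "flip i (flip i x) = x"
  by (auto simp: flip_def fun_eq_iff)

lemma flip_neq [simp]: "flip i x \<noteq> x" "x \<noteq> flip i x"
  by (auto simp: flip_def fun_eq_iff split: if_splits)

lemma flip_inj: "flip i x = flip j x \<longleftrightarrow> i = j"
  by (auto simp: flip_def fun_eq_iff split: if_splits)

lemma flip_in_hypercube [simp]: "i < N \<Longrightarrow> flip i x \<in> hypercube N \<longleftrightarrow> x \<in> hypercube N"
  by (auto simp: flip_def hypercube_def)

lemma origin_in_hypercube [simp]: "origin \<in> hypercube N"
  by (simp add: hypercube_def)

lemma shift_shift [simp]: "shift a (shift a x) = x"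
  by (auto simp: shift_def)

lemma shift_self [simp]: "shift a a = origin"
  by (auto simp: shift_def)

lemma shift_origin [simp]: "shift a origin = a"
  by (auto simp: shift_def)

lemma shift_in_hypercube: "a \<in> hypercube N \<Longrightarrow> x \<in> hypercube N \<Longrightarrow> shift a x \<in> hypercube N"
  by (auto simp: shift_def hypercube_def)

lemma shift_flip: "shift a (flip i x) = flip i (shift a x)"
  by (auto simp: shift_def flip_def add_ac)

lemma inj_shift: "inj (shift a)"
  by (metis injI shift_shift)

lemma card_hypercube: "card (hypercube N) = 2 ^ N"
proof -
  have "bij_betw (\<lambda>S i. if i \<in> S then 1 else (0::bit)) (Pow {..<N}) (hypercube N)"
  proof (rule bij_betwI[where g = "\<lambda>x. {i. x i = 1}"])
    show "(\<lambda>x. {i. x i = 1}) \<in> hypercube N \<rightarrow> Pow {..<N}"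
      by (auto simp: hypercube_def) (metis not_le zero_neq_one)
  qed (auto simp: hypercube_def fun_eq_iff)
  then show ?thesis
    using bij_betw_same_card[of _ "Pow {..<N}" "hypercube N"] by (simp add: card_Pow)
qed

lemma adj_sym: "adj N x y \<longleftrightarrow> adj N y x"
  unfolding adj_def by (metis flip_flip)

lemma successively_adj_rev: "successively (adj N) (rev xs) \<longleftrightarrow> successively (adj N) xs"
proof -
  have "(\<lambda>x y. adj N y x) = adj N"
    by (intro ext) (rule adj_sym)
  then show ?thesis
    unfolding successively_rev by (rule arg_cong)
qed

lemma saw_Cons:
  "saw N (x # xs) \<longleftrightarrow> x \<in> hypercube N \<and>
     (xs = [] \<or> saw N xs \<and> x \<notin> set xs \<and> adj N x (hd xs))"
  by (cases xs) (auto simp: saw_def)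

lemma hd_saw: "saw N xs \<Longrightarrow> hd xs \<in> hypercube N"
  and last_saw: "saw N xs \<Longrightarrow> last xs \<in> hypercube N"
  unfolding saw_def using hd_in_set last_in_set by blast+

lemma saw_append:
  assumes "xs \<noteq> []" "ys \<noteq> []"
  shows "saw N (xs @ ys) \<longleftrightarrow>
    saw N xs \<and> saw N ys \<and> adj N (last xs) (hd ys) \<and> set xs \<inter> set ys = {}"
  using assms by (auto simp: saw_def successively_append_iff)

lemma saw_rev: "saw N (rev xs) \<longleftrightarrow> saw N xs"
  by (simp add: saw_def successively_adj_rev del: successively_rev)

lemma saw_shift:
  assumes "saw N xs" "a \<in> hypercube N"
  shows "saw N (map (shift a) xs)"
proof -
  have "successively (adj N) (map (shift a) xs)"
    using assms(1) unfolding saw_def successively_map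
    by (auto elim!: successively_mono simp: adj_def shift_flip)
  then show ?thesis
    using assms inj_shift[of a] by (auto simp: saw_def distinct_map shift_in_hypercube intro: inj_on_subset)
qed

lemma length_saw_le: "saw N xs \<Longrightarrow> length xs \<le> 2 ^ N"
  unfolding saw_def using card_hypercube card_mono[OF finite_hypercube] by (metis distinct_card)

lemma finite_saw: "finite {xs. saw N xs}"
  by (rule finite_subset[OF _ finite_lists_length_le[OF finite_hypercube[of N], of "2 ^ N"]])
     (use length_saw_le in \<open>auto simp: saw_def\<close>)

lemma finite_saws [simp]: "finite (saws N L x)"
  by (rule finite_subset[OF _ finite_saw[of N]]) (auto simp: saws_def)

lemma weight_nonneg: "z \<ge> 0 \<Longrightarrow> weight z xs \<ge> 0"
  by (simp add: weight_def)

lemma gf_nonneg: "z \<ge> 0 \<Longrightarrow> gf N z L x \<ge> 0"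
  unfolding gf_def by (intro sum_nonneg weight_nonneg)

section \<open>Invariance under translation and reversal\<close>

lemma saws_shift:
  assumes "a \<in> hypercube N"
  shows "saws N (shift a ` L) (shift a x) = map (shift a) ` saws N L x"
proof -
  have *: "map (shift a) xs \<in> saws N (shift a ` L) (shift a x)" if "xs \<in> saws N L x" for L x xs
  proof -
    have "saw N xs" "hd xs = x" "last xs \<in> L" "xs \<noteq> []"
      using that by (auto simp: saws_def saw_def)
    then show ?thesis
      by (simp add: saws_def saw_shift assms hd_map last_map)
  qed
  show ?thesis
  proof (intro equalityI subsetI)
    fix xs assume "xs \<in> saws N (shift a ` L) (shift a x)"
    from *[OF this] have "map (shift a) xs \<in> saws N L x"
      by (simp only: image_image shift_shift image_ident)
    moreover have "xs = map (shift a) (map (shift a) xs)"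
      by (simp add: o_def)
    ultimately show "xs \<in> map (shift a) ` saws N L x" by blast
  next
    fix xs assume "xs \<in> map (shift a) ` saws N L x"
    then show "xs \<in> saws N (shift a ` L) (shift a x)"
      by (elim imageE) (hypsubst, rule *)
  qed
qed

lemma gf_shift:
  assumes "a \<in> hypercube N"
  shows "gf N z (shift a ` L) (shift a x) = gf N z L x"
proof -
  have "inj_on (map (shift a)) (saws N L x)"
    using inj_mapI[OF inj_shift[of a]] by (rule inj_on_subset) simp
  then show ?thesis
    unfolding gf_def saws_shift[OF assms] by (simp add: sum.reindex weight_def)
qed

lemma range_shift [simp]: "range (shift a) = UNIV"
  by (rule surjI[of _ "shift a"]) (rule shift_shift)

lemma gf_UNIV:
  assumes "x \<in> hypercube N"
  shows "gf N z UNIV x = gf N z UNIV origin"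
  using gf_shift[OF assms, of z UNIV origin] by simp

lemma two_point_shift:
  assumes "a \<in> hypercube N"
  shows "two_point N z (shift a x) (shift a y) = two_point N z x y"
  using gf_shift[OF assms, of z "{y}" x] by simp

lemma two_point_sym: "two_point N z x y = two_point N z y x"
proof -
  have "saws N {y} x = rev ` saws N {x} y" for x y
  proof -
    have *: "rev xs \<in> saws N {y} x" if "xs \<in> saws N {x} y" for xs x y
    proof -
      have "saw N xs" "hd xs = y" "last xs = x" "xs \<noteq> []"
        using that by (auto simp: saws_def saw_def)
      then show ?thesis
        by (simp add: saws_def saw_rev hd_rev last_rev)
    qed
    show ?thesis
    proof (intro equalityI subsetI)
      fix xs assume "xs \<in> saws N {y} x"
      then show "xs \<in> rev ` saws N {x} y"
        by (intro image_eqI[OF _ *]) auto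
    next
      fix xs assume "xs \<in> rev ` saws N {x} y"
      then show "xs \<in> saws N {y} x"
        by (elim imageE) (hypsubst, rule *)
    qed
  qed
  then have "saws N {y} x = rev ` saws N {x} y" .
  then show ?thesis
    unfolding gf_def by (simp add: sum.reindex weight_def)
qed

lemma gf_UNIV_eq_sum_two_point:
  "gf N z UNIV x = (\<Sum>y\<in>hypercube N. two_point N z x y)"
proof -
  have "saws N UNIV x = (\<Union>y\<in>hypercube N. saws N {y} x)"
    by (auto simp: saws_def last_saw)
  then show ?thesis
    unfolding gf_def
    by (simp only:) (rule sum.UNION_disjoint, auto simp: finite_hypercube, auto simp: saws_def)
qed

section \<open>Cutting walks at a vertex\<close>

text \<open>Cutting at \<open>v\<close> yields a walk to \<open>v\<close> and a walk from
  \<open>v\<close>, whose weights multiply; forgetting that the two avoid each other only adds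
  pairs.\<close>

lemma sum_weight_via_le:
  assumes "z \<ge> 0"
  shows "(\<Sum>xs\<in>{xs \<in> saws N L x. v \<in> set xs}. weight z xs) \<le> two_point N z x v * gf N z L v"
proof -
  let ?J = "\<lambda>(p, q). p @ tl q"
  have sub: "{xs \<in> saws N L x. v \<in> set xs} \<subseteq> ?J ` (saws N {v} x \<times> saws N L v)"
  proof
    fix xs assume xs: "xs \<in> {xs \<in> saws N L x. v \<in> set xs}"
    then obtain us vs where e: "xs = us @ v # vs"
      by (auto dest: split_list)
    have s: "saw N xs" "hd xs = x" "last xs \<in> L" using xs by (auto simp: saws_def)
    have "us @ [v] \<in> saws N {v} x"
    proof (cases vs)
      case (Cons w ws)
      have "saw N ((us @ [v]) @ vs)" using s(1) e by simp
      then have "saw N (us @ [v])" by (subst (asm) saw_append) (auto simp: Cons)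
      then show ?thesis using s e by (auto simp: saws_def hd_append)
    qed (use s e in \<open>auto simp: saws_def hd_append\<close>)
    moreover have "v # vs \<in> saws N L v"
    proof (cases "us = []")
      case False
      have "saw N (us @ v # vs)" using s(1) e by simp
      then have "saw N (v # vs)" by (subst (asm) saw_append) (auto simp: False)
      then show ?thesis using s e by (auto simp: saws_def)
    qed (use s e in \<open>auto simp: saws_def\<close>)
    ultimately show "xs \<in> ?J ` (saws N {v} x \<times> saws N L v)"
      by (intro image_eqI[where x = "(us @ [v], v # vs)"]) (auto simp: e)
  qed
  have w: "weight z (p @ tl q) = weight z p * weight z q"
    if "p \<in> saws N {v} x" "q \<in> saws N L v" for p q
  proof -
    have "p \<noteq> []" "q \<noteq> []" using that by (auto simp: saws_def saw_def)
    then have "length (p @ tl q) - 1 = (length p - 1) + (length q - 1)"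
      by (cases p; cases q) simp_all
    then show ?thesis by (simp only: weight_def power_add)
  qed
  have "(\<Sum>xs\<in>{xs \<in> saws N L x. v \<in> set xs}. weight z xs)
      \<le> (\<Sum>xs\<in>?J ` (saws N {v} x \<times> saws N L v). weight z xs)"
    by (rule sum_mono2) (use sub assms in \<open>auto simp: weight_nonneg\<close>)
  also have "\<dots> \<le> (\<Sum>pq\<in>saws N {v} x \<times> saws N L v. (weight z \<circ> ?J) pq)"
    by (rule sum_image_le) (auto simp: weight_nonneg assms)
  also have "\<dots> = (\<Sum>(p, q)\<in>saws N {v} x \<times> saws N L v. weight z p * weight z q)"
    by (intro sum.cong) (auto simp: w)
  also have "\<dots> = two_point N z x v * gf N z L v"
    by (simp add: gf_def sum_product sum.cartesian_product)
  finally show ?thesis .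
qed

lemma gf_split:
  "gf N z L x = (\<Sum>xs\<in>{xs \<in> saws N L x. v \<in> set xs}. weight z xs)
     + (\<Sum>xs\<in>{xs \<in> saws N L x. v \<notin> set xs}. weight z xs)"
  unfolding gf_def
  by (subst sum.union_disjoint[symmetric]) (auto intro!: sum.cong)

lemma weight_Cons: "xs \<noteq> [] \<Longrightarrow> weight z (x # xs) = z * weight z xs"
  by (cases xs) (auto simp: weight_def)

lemma saws_first_step:
  assumes "x \<in> hypercube N"
  shows "saws N L x = (if x \<in> L then {[x]} else {}) \<union>
    (\<Union>i<N. (#) x ` {xs \<in> saws N L (flip i x). x \<notin> set xs})"
proof (intro equalityI subsetI)
  fix xs assume xs: "xs \<in> saws N L x"
  then obtain ys where ys: "xs = x # ys"
    by (cases xs) (auto simp: saws_def saw_def)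
  show "xs \<in> (if x \<in> L then {[x]} else {}) \<union>
    (\<Union>i<N. (#) x ` {xs \<in> saws N L (flip i x). x \<notin> set xs})"
  proof (cases "ys = []")
    case False
    then obtain i where "i < N" "hd ys = flip i x" "saw N ys" "x \<notin> set ys"
      using xs ys by (auto simp: saws_def saw_Cons adj_def)
    then show ?thesis using xs ys False by (auto simp: saws_def)
  qed (use xs ys in \<open>auto simp: saws_def\<close>)
next
  fix xs assume "xs \<in> (if x \<in> L then {[x]} else {}) \<union>
    (\<Union>i<N. (#) x ` {xs \<in> saws N L (flip i x). x \<notin> set xs})"
  then show "xs \<in> saws N L x"
    using assms by (auto simp: saws_def saw_Cons adj_def saw_def[of N "[]"] split: if_splits)
qed

lemma gf_first_step:
  assumes "x \<in> hypercube N"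
  shows "gf N z L x = of_bool (x \<in> L) +
    z * (\<Sum>i<N. \<Sum>xs\<in>{xs \<in> saws N L (flip i x). x \<notin> set xs}. weight z xs)"
proof -
  let ?S = "\<lambda>i. {xs \<in> saws N L (flip i x). x \<notin> set xs}"
  have fin: "finite (?S i)" for i
    by (rule finite_subset[of _ "saws N L (flip i x)"]) auto
  have "gf N z L x = (\<Sum>xs\<in>(if x \<in> L then {[x]} else {}). weight z xs) +
      (\<Sum>xs\<in>(\<Union>i<N. (#) x ` ?S i). weight z xs)"
    unfolding gf_def saws_first_step[OF assms, of L]
    by (rule sum.union_disjoint) (auto simp: fin, auto simp: saws_def saw_def[of N "[]"])
  also have "(\<Sum>xs\<in>(if x \<in> L then {[x]} else {}). weight z xs) = of_bool (x \<in> L)"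
    by (simp add: weight_def)
  also have "(\<Sum>xs\<in>(\<Union>i<N. (#) x ` ?S i). weight z xs) = (\<Sum>i<N. \<Sum>xs\<in>(#) x ` ?S i. weight z xs)"
    by (rule sum.UNION_disjoint) (auto simp: fin, auto simp: saws_def flip_inj)
  also have "\<dots> = (\<Sum>i<N. \<Sum>xs\<in>?S i. z * weight z xs)"
  proof (rule sum.cong[OF refl])
    fix i
    have "(\<Sum>xs\<in>(#) x ` ?S i. weight z xs) = (\<Sum>xs\<in>?S i. weight z (x # xs))"
      by (subst sum.reindex) auto
    also have "\<dots> = (\<Sum>xs\<in>?S i. z * weight z xs)"
      by (intro sum.cong refl weight_Cons) (auto simp: saws_def saw_def)
    finally show "(\<Sum>xs\<in>(#) x ` ?S i. weight z xs) = (\<Sum>xs\<in>?S i. z * weight z xs)" .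
  qed
  finally show ?thesis by (simp add: sum_distrib_left)
qed

text \<open>The walks from \<open>flip i x\<close> that return to \<open>x\<close> must be removed;
  \<open>sum_weight_via_le\<close> bounds them from above, so possibly too much is
  subtracted.\<close>

lemma gf_ge_first_step:
  assumes "x \<in> hypercube N" "z \<ge> 0"
  shows "gf N z L x \<ge> of_bool (x \<in> L) +
    z * (\<Sum>i<N. gf N z L (flip i x) - two_point N z (flip i x) x * gf N z L x)"
proof -
  have "gf N z L (flip i x) - two_point N z (flip i x) x * gf N z L x
      \<le> (\<Sum>xs\<in>{xs \<in> saws N L (flip i x). x \<notin> set xs}. weight z xs)" for i
    using sum_weight_via_le[OF assms(2), of N L "flip i x" x] gf_split[of N z L "flip i x" x] by linarith
  then show ?thesis
    unfolding gf_first_step[OF assms(1), of z L]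
    by (intro add_left_mono mult_left_mono sum_mono assms)
qed

text \<open>Of the walks revisiting \<open>x\<close> only those that step back to \<open>x\<close> at once are discarded.\<close>

lemma gf_le_first_step:
  assumes "x \<in> hypercube N" "z \<ge> 0"
  shows "gf N z L x \<le> of_bool (x \<in> L) +
    z * (\<Sum>i<N. gf N z L (flip i x) -
       z * (gf N z L x - two_point N z x (flip i x) * gf N z L (flip i x)))"
proof -
  have "(\<Sum>xs\<in>{xs \<in> saws N L (flip i x). x \<notin> set xs}. weight z xs) \<le> gf N z L (flip i x) -
       z * (gf N z L x - two_point N z x (flip i x) * gf N z L (flip i x))" if i: "i < N" for i
  proof -
    let ?e = "flip i x"
    let ?S = "{ys \<in> saws N L x. ?e \<notin> set ys}"
    \<comment> \<open>Stepping back at once gives the lists \<open>?e # ys\<close> with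
      \<open>ys\<close> from \<open>x\<close> avoiding \<open>?e\<close>; the \<open>ys\<close> that
      do hit \<open>?e\<close> are again bounded by cutting.\<close>
    have "z * (gf N z L x - two_point N z x ?e * gf N z L ?e) \<le> z * (\<Sum>ys\<in>?S. weight z ys)"
      using sum_weight_via_le[OF assms(2), of N L x ?e] gf_split[of N z L x ?e] assms(2)
      by (intro mult_left_mono) linarith+
    also have "\<dots> = (\<Sum>xs\<in>(#) ?e ` ?S. weight z xs)"
      by (auto simp: sum.reindex sum_distrib_left weight_Cons saws_def saw_def intro!: sum.cong)
    also have "\<dots> \<le> (\<Sum>xs\<in>{xs \<in> saws N L ?e. x \<in> set xs}. weight z xs)"
    proof (rule sum_mono2)
      show "(#) ?e ` ?S \<subseteq> {xs \<in> saws N L ?e. x \<in> set xs}"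
      proof
        fix xs assume "xs \<in> (#) ?e ` ?S"
        then obtain ys where ys: "xs = ?e # ys" "saw N ys" "hd ys = x" "last ys \<in> L" "?e \<notin> set ys"
          by (auto simp: saws_def)
        then have "ys \<noteq> []" by (auto simp: saw_def)
        moreover have "adj N ?e x" using i by (auto simp: adj_def intro!: exI[of _ i])
        ultimately show "xs \<in> {xs \<in> saws N L ?e. x \<in> set xs}"
          using ys i assms(1) by (auto simp: saws_def saw_Cons)
      qed
    qed (auto simp: weight_nonneg assms)
    finally show ?thesis using gf_split[of N z L ?e x] by linarith
  qed
  then show ?thesis
    unfolding gf_first_step[OF assms(1), of z L]
    by (intro add_left_mono mult_left_mono sum_mono assms) auto
qed

section \<open>The susceptibility and its derivative\<close>

lemma adj_iff_hweight:
  assumes "x \<in> hypercube N" "y \<in> hypercube N"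
  shows "adj N x y \<longleftrightarrow> hweight N (\<lambda>k. y k - x k) = 1"
proof
  assume "adj N x y"
  then obtain i where i: "i < N" "y = flip i x" by (auto simp: adj_def)
  then have "{k. k < N \<and> y k - x k = 1} = {i}"
    by (auto simp: flip_def)
  then show "hweight N (\<lambda>k. y k - x k) = 1"
    by (simp add: hweight_def)
next
  assume "hweight N (\<lambda>k. y k - x k) = 1"
  then obtain i where i: "{k. k < N \<and> y k - x k = 1} = {i}"
    unfolding hweight_def by (auto simp: card_1_singleton_iff)
  have "y k = flip i x k" for k
  proof (cases "k < N")
    case True
    have "y k - x k = 1 \<longleftrightarrow> k = i" using i True by blast
    then show ?thesis by (cases "x k"; cases "y k") (auto simp: flip_def)
  next
    case False
    then have "k \<noteq> i" using i by blast
    then show ?thesis using False assms by (auto simp: flip_def hypercube_def)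
  qed
  moreover have "i < N" using i by blast
  ultimately show "adj N x y" by (auto simp: adj_def)
qed

text \<open>Listing the values is a bijection because walks are extensional: nothing outside
  \<open>{0..n}\<close> has to be recovered. An \<open>n\<close>-step walk has \<open>Suc n\<close>
  vertices.\<close>

lemma saw_count_eq_card_saws:
  "saw_count N n = card {xs \<in> saws N UNIV origin. length xs = Suc n}"
proof -
  have "bij_betw (\<lambda>\<omega>. map \<omega> [0..<Suc n]) {\<omega> \<in> self_avoiding_walks N n. \<omega> 0 = (\<lambda>k. 0)}
      {xs \<in> saws N UNIV origin. length xs = Suc n}"
  proof (rule bij_betwI[where g = "\<lambda>xs. \<lambda>i\<in>{0..n}. xs ! i"])
    show "(\<lambda>\<omega>. map \<omega> [0..<Suc n]) \<in> {\<omega> \<in> self_avoiding_walks N n. \<omega> 0 = (\<lambda>k. 0)} \<rightarrow>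
      {xs \<in> saws N UNIV origin. length xs = Suc n}"
    proof
      fix \<omega> assume "\<omega> \<in> {\<omega> \<in> self_avoiding_walks N n. \<omega> 0 = (\<lambda>k. 0)}"
      then have w: "\<omega> \<in> {0..n} \<rightarrow>\<^sub>E hypercube N" "inj_on \<omega> {0..n}" "\<omega> 0 = origin"
        and st: "\<And>i. i \<in> {1..n} \<Longrightarrow> hweight N (\<lambda>k. \<omega> i k - \<omega> (i - 1) k) = 1"
        by (auto simp: self_avoiding_walks_def)
      have H: "\<omega> i \<in> hypercube N" if "i \<le> n" for i using w(1) that by auto
      have e: "set [0..<Suc n] = {0..n}" by auto
      have "adj N (\<omega> i) (\<omega> (Suc i))" if "i < n" for i
        using st[of "Suc i"] that H by (subst adj_iff_hweight) auto
      then have "successively (adj N) (map \<omega> [0..<Suc n])"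
        by (auto simp: successively_conv_nth simp del: upt_Suc)
      moreover have "distinct (map \<omega> [0..<Suc n])"
        using w(2) by (simp only: distinct_map e) auto
      moreover have "set (map \<omega> [0..<Suc n]) \<subseteq> hypercube N"
        using H by auto
      moreover have "hd (map \<omega> [0..<Suc n]) = origin"
        using w(3) by (simp add: hd_map del: upt_Suc)
      ultimately show "map \<omega> [0..<Suc n] \<in> {xs \<in> saws N UNIV origin. length xs = Suc n}"
        by (simp add: saws_def saw_def del: upt_Suc)
    qed
    show "(\<lambda>xs. \<lambda>i\<in>{0..n}. xs ! i) \<in> {xs \<in> saws N UNIV origin. length xs = Suc n} \<rightarrow>
      {\<omega> \<in> self_avoiding_walks N n. \<omega> 0 = (\<lambda>k. 0)}"
    proof
      fix xs assume "xs \<in> {xs \<in> saws N UNIV origin. length xs = Suc n}"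
      then have xs: "length xs = Suc n" "distinct xs" "set xs \<subseteq> hypercube N" "successively (adj N) xs"
        "hd xs = origin"
        by (auto simp: saws_def saw_def)
      have H: "xs ! i \<in> hypercube N" if "i \<le> n" for i
        using xs(3) nth_mem[of i xs] that by (auto simp: xs(1))
      have "hweight N (\<lambda>k. (xs ! i) k - (xs ! (i - 1)) k) = 1" if "i \<in> {1..n}" for i
      proof -
        have "adj N (xs ! (i - 1)) (xs ! Suc (i - 1))"
          by (rule successively_nth[OF xs(4)]) (use xs(1) that in auto)
        moreover have "Suc (i - 1) = i" using that by auto
        ultimately have "adj N (xs ! (i - 1)) (xs ! i)" by metis
        then show ?thesis
          using H[of i] H[of "i - 1"] that by (subst (asm) adj_iff_hweight) auto
      qed
      moreover have "(\<lambda>i\<in>{0..n}. xs ! i) i = xs ! i" "(\<lambda>i\<in>{0..n}. xs ! i) (i - 1) = xs ! (i - 1)"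
        if "i \<in> {1..n}" for i
        using that by auto
      ultimately have "\<forall>i\<in>{1..n}. hweight N (\<lambda>k. (\<lambda>i\<in>{0..n}. xs ! i) i k - (\<lambda>i\<in>{0..n}. xs ! i) (i - 1) k) = 1"
        by metis
      moreover have "xs ! 0 = origin" using xs(1,5) by (cases xs) auto
      moreover have "inj_on (\<lambda>i\<in>{0..n}. xs ! i) {0..n}"
      proof -
        have "inj_on (nth xs) {0..n}" by (rule inj_on_nth) (use xs(1,2) in auto)
        then show ?thesis by (simp add: inj_on_def)
      qed
      moreover have "(\<lambda>i\<in>{0..n}. xs ! i) \<in> {0..n} \<rightarrow>\<^sub>E hypercube N"
        using H by (intro restrict_PiE_iff[THEN iffD2]) auto
      ultimately show "(\<lambda>i\<in>{0..n}. xs ! i) \<in> {\<omega> \<in> self_avoiding_walks N n. \<omega> 0 = (\<lambda>k. 0)}"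
        by (simp add: self_avoiding_walks_def)
    qed
  next
    fix \<omega> assume "\<omega> \<in> {\<omega> \<in> self_avoiding_walks N n. \<omega> 0 = (\<lambda>k. 0)}"
    then have "\<omega> \<in> extensional {0..n}" by (auto simp: self_avoiding_walks_def PiE_def)
    then show "(\<lambda>i\<in>{0..n}. map \<omega> [0..<Suc n] ! i) = \<omega>"
      by (intro extensionalityI[OF restrict_extensional]) (auto simp del: upt_Suc)
  next
    fix xs assume "xs \<in> {xs \<in> saws N UNIV origin. length xs = Suc n}"
    then show "map (\<lambda>i\<in>{0..n}. xs ! i) [0..<Suc n] = xs"
      by (intro nth_equalityI) (auto simp del: upt_Suc)
  qed
  then show ?thesis unfolding saw_count_def by (rule bij_betw_same_card)
qed

text \<open>The arbitrary \<open>h\<close> covers both the susceptibility and the derivative of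
  \<open>z * susceptibility N z\<close>, which has an extra factor \<open>Suc n\<close>.\<close>

lemma sum_saws_by_length:
  fixes h :: "nat \<Rightarrow> real"
  shows "(\<Sum>n=0..vol N - 1. real (saw_count N n) * h n) = (\<Sum>xs\<in>saws N UNIV origin. h (length xs - 1))"
proof -
  have "(\<Sum>n=0..vol N - 1. real (saw_count N n) * h n) =
      (\<Sum>n=0..vol N - 1. \<Sum>xs\<in>{xs \<in> saws N UNIV origin. length xs - 1 = n}. h (length xs - 1))"
  proof (rule sum.cong[OF refl])
    fix n
    have "{xs \<in> saws N UNIV origin. length xs = Suc n} = {xs \<in> saws N UNIV origin. length xs - 1 = n}"
      by (auto simp: saws_def saw_def)
    then show "real (saw_count N n) * h n =
        (\<Sum>xs\<in>{xs \<in> saws N UNIV origin. length xs - 1 = n}. h (length xs - 1))"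
      by (simp add: saw_count_eq_card_saws)
  qed
  also have "\<dots> = (\<Sum>xs\<in>saws N UNIV origin. h (length xs - 1))"
  proof (rule sum.group)
    \<comment> \<open>A self-avoiding walk visits at most \<open>2 ^ N\<close> vertices, so the
      range of the sum reaches every possible length.\<close>
    show "(\<lambda>xs. length xs - 1) ` saws N UNIV origin \<subseteq> {0..vol N - 1}"
      using length_saw_le by (auto simp: saws_def vol_def intro!: diff_le_mono)
  qed auto
  finally show ?thesis .
qed

lemma susceptibility_eq_gf: "susceptibility N z = gf N z UNIV origin"
  unfolding susceptibility_def gf_def weight_def by (rule sum_saws_by_length)

section \<open>Double counting for the derivative\<close>

text \<open>The factor counts vertices, one more than steps, as it comes from differentiating
  \<open>z ^ Suc n\<close>; it amounts to marking a vertex of the walk.\<close>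

definition gf_len :: "nat \<Rightarrow> real \<Rightarrow> (nat \<Rightarrow> bit) \<Rightarrow> real" where
  "gf_len N z x = (\<Sum>xs\<in>saws N UNIV x. real (length xs) * weight z xs)"

lemma has_derivative_susceptibility:
  "((\<lambda>z. z * susceptibility N z) has_real_derivative gf_len N z origin) (at z)"
proof -
  have "((\<lambda>z. z * susceptibility N z) has_real_derivative
      (\<Sum>n=0..vol N - 1. real (saw_count N n) * (real (Suc n) * z ^ n))) (at z)"
  proof -
    have e: "(\<lambda>z. z * susceptibility N z) =
        (\<lambda>z. \<Sum>n=0..vol N - 1. real (saw_count N n) * z ^ Suc n)"
      by (auto simp: susceptibility_def sum_distrib_left mult_ac)
    show ?thesis
      unfolding e
    proof (rule DERIV_sum)
      fix n
      show "((\<lambda>z. real (saw_count N n) * z ^ Suc n) has_real_derivative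
          real (saw_count N n) * (real (Suc n) * z ^ n)) (at z)"
        using DERIV_cmult[OF DERIV_pow[of "Suc n" z], of "real (saw_count N n)"] by simp
    qed
  qed
  also have "(\<Sum>n=0..vol N - 1. real (saw_count N n) * (real (Suc n) * z ^ n)) = gf_len N z origin"
    unfolding sum_saws_by_length gf_len_def weight_def
    by (intro sum.cong) (auto simp: saws_def saw_def)
  finally show ?thesis .
qed

lemma gf_len_shift:
  assumes "a \<in> hypercube N"
  shows "gf_len N z a = gf_len N z origin"
proof -
  have "inj_on (map (shift a)) (saws N UNIV origin)"
    using inj_mapI[OF inj_shift[of a]] by (rule inj_on_subset) simp
  moreover have "saws N UNIV a = map (shift a) ` saws N UNIV origin"
    using saws_shift[OF assms, of UNIV origin] by simp
  ultimately show ?thesis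
    unfolding gf_len_def by (simp add: sum.reindex weight_def)
qed

definition gf_disjoint :: "nat \<Rightarrow> real \<Rightarrow> (nat \<Rightarrow> bit) \<Rightarrow> real" where
  "gf_disjoint N z v = (\<Sum>(a, b)\<in>{(a, b) \<in> saws N UNIV v \<times> saws N UNIV v. set a \<inter> set b = {v}}.
     weight z a * weight z b)"

text \<open>Reversing the first arm and appending the second without its copy of \<open>v\<close> is
  a bijection from pairs of arms that meet only at \<open>v\<close> to walks through
  \<open>v\<close>.\<close>

lemma sum_weight_through:
  assumes v: "v \<in> hypercube N"
  shows "(\<Sum>xs\<in>{xs. saw N xs \<and> v \<in> set xs}. weight z xs) = gf_disjoint N z v"
proof -
  let ?P = "{(a, b) \<in> saws N UNIV v \<times> saws N UNIV v. set a \<inter> set b = {v}}"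
  let ?J = "\<lambda>(a, b). rev a @ tl b"
  have form: "\<exists>a' b'. a = v # a' \<and> b = v # b' \<and> v \<notin> set a' \<and> v \<notin> set b' \<and>
      saw N (rev a' @ v # b')" if "(a, b) \<in> ?P" for a b
  proof -
    have ab: "saw N a" "saw N b" "hd a = v" "hd b = v" "set a \<inter> set b = {v}"
      using that by (auto simp: saws_def)
    then obtain a' b' where e: "a = v # a'" "b = v # b'"
      by (cases a; cases b) (auto simp: saw_def)
    have "v \<notin> set a'" "v \<notin> set b'" using ab e by (auto simp: saw_def)
    moreover have "saw N (rev a' @ v # b')"
    proof (cases "a' = []")
      case False
      have "saw N (rev a')" "adj N (hd a') v" using ab(1) e False
        by (auto simp: saw_Cons saw_rev adj_sym[of N v])
      moreover have "set a' \<inter> set (v # b') = {}" using ab(5) e \<open>v \<notin> set a'\<close> by auto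
      ultimately show ?thesis using ab(2) e False
        by (subst saw_append) (auto simp: last_rev)
    qed (use ab e in auto)
    ultimately show ?thesis using e by blast
  qed
  have inj: "inj_on ?J ?P"
  proof (rule inj_onI, clarify)
    fix a b c d assume *: "a \<in> saws N UNIV v" "b \<in> saws N UNIV v" "set a \<inter> set b = {v}"
      "c \<in> saws N UNIV v" "d \<in> saws N UNIV v" "set c \<inter> set d = {v}" "rev a @ tl b = rev c @ tl d"
    have "(a, b) \<in> ?P" "(c, d) \<in> ?P" using * by auto
    from form[OF this(1)] form[OF this(2)] obtain a' b' c' d' where
      e: "a = v # a'" "b = v # b'" "v \<notin> set a'" "v \<notin> set b'"
         "c = v # c'" "d = v # d'" "v \<notin> set c'" "v \<notin> set d'" by blast
    have "rev a' @ v # b' = rev c' @ v # d'"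
      using *(7) unfolding e by simp
    \<comment> \<open>\<open>v\<close> occurs only once, so its position determines where to
      split.\<close>
    moreover have "v \<notin> set (rev a')" using e(3) by simp
    ultimately have "rev a' = rev c' \<and> b' = d'"
      using append_Cons_eq_iff[of v "rev a'" b' "rev c'" d'] e(4) by blast
    then show "a = c \<and> b = d" unfolding e by simp
  qed
  have "{xs. saw N xs \<and> v \<in> set xs} = ?J ` ?P"
  proof (intro equalityI subsetI)
    fix xs assume "xs \<in> {xs. saw N xs \<and> v \<in> set xs}"
    then obtain us vs where e: "xs = us @ v # vs" and s: "saw N xs"
      by (auto dest: split_list)
    have "saw N (v # vs)" "saw N (us @ [v])" "v \<notin> set us" "v \<notin> set vs" "set us \<inter> set vs = {}"
    proof -
      show "saw N (v # vs)"
        using s e saw_append[of us "v # vs" N] by (cases "us = []") auto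
      show "saw N (us @ [v])"
        using s e saw_append[of "us @ [v]" vs N] by (cases "vs = []") auto
    qed (use s e in \<open>auto simp: saw_def\<close>)
    moreover from this have "saw N (v # rev us)"
      using saw_rev[of N "us @ [v]"] by simp
    ultimately have "(v # rev us, v # vs) \<in> ?P"
      by (auto simp: saws_def)
    then have "?J (v # rev us, v # vs) \<in> ?J ` ?P"
      by (rule imageI)
    moreover have "?J (v # rev us, v # vs) = xs"
      by (simp add: e)
    ultimately show "xs \<in> ?J ` ?P"
      by (simp only:)
  next
    fix xs assume "xs \<in> ?J ` ?P"
    then obtain p where p: "xs = ?J p" "p \<in> ?P" by (rule imageE)
    obtain a b where ab: "p = (a, b)" by (rule prod.exhaust)
    from p ab have "(a, b) \<in> ?P" "xs = rev a @ tl b" by simp_all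
    moreover from form[OF this(1)] obtain a' b' where "a = v # a'" "b = v # b'"
      "saw N (rev a' @ v # b')" by blast
    ultimately show "xs \<in> {xs. saw N xs \<and> v \<in> set xs}"
      by simp
  qed
  then have "(\<Sum>xs\<in>{xs. saw N xs \<and> v \<in> set xs}. weight z xs) = (\<Sum>p\<in>?P. weight z (?J p))"
    by (simp only: sum.reindex[OF inj] o_def)
  moreover have "weight z (rev a @ tl b) = weight z a * weight z b" if ab: "(a, b) \<in> ?P" for a b
  proof -
    obtain a' b' where "a = v # a'" "b = v # b'" using form[OF ab] by blast
    then show ?thesis by (simp add: weight_def power_add)
  qed
  ultimately show ?thesis
    unfolding gf_disjoint_def by (simp only:) (rule sum.cong, auto)
qed

text \<open>Both sides count walks with a marked vertex, grouped by the starting point on the left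
  and by the marked vertex on the right.\<close>

lemma sum_gf_len: "(\<Sum>x\<in>hypercube N. gf_len N z x) = (\<Sum>v\<in>hypercube N. gf_disjoint N z v)"
proof -
  have "(\<Sum>x\<in>hypercube N. gf_len N z x) = (\<Sum>xs\<in>(\<Union>x\<in>hypercube N. saws N UNIV x). real (length xs) * weight z xs)"
    unfolding gf_len_def
    by (subst sum.UNION_disjoint) (auto simp: finite_hypercube, auto simp: saws_def)
  also have "(\<Union>x\<in>hypercube N. saws N UNIV x) = {xs. saw N xs}"
    by (auto simp: saws_def hd_saw)
  also have "(\<Sum>xs\<in>{xs. saw N xs}. real (length xs) * weight z xs) =
      (\<Sum>xs\<in>{xs. saw N xs}. \<Sum>v\<in>hypercube N. if v \<in> set xs then weight z xs else 0)"
  proof (rule sum.cong[OF refl])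
    fix xs assume "xs \<in> {xs. saw N xs}"
    then have "hypercube N \<inter> {v. v \<in> set xs} = set xs" "distinct xs" by (auto simp: saw_def)
    then show "real (length xs) * weight z xs = (\<Sum>v\<in>hypercube N. if v \<in> set xs then weight z xs else 0)"
      by (simp add: sum.If_cases finite_hypercube distinct_card)
  qed
  also have "\<dots> = (\<Sum>v\<in>hypercube N. \<Sum>xs\<in>{xs. saw N xs}. if v \<in> set xs then weight z xs else 0)"
    by (rule sum.swap)
  also have "\<dots> = (\<Sum>v\<in>hypercube N. \<Sum>xs\<in>{xs. saw N xs \<and> v \<in> set xs}. weight z xs)"
    by (simp add: sum.inter_filter[symmetric] finite_saw)
  finally show ?thesis by (simp add: sum_weight_through)
qed

lemma sum_UNION_le:
  fixes f :: "'b \<Rightarrow> real"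
  assumes "finite I" "\<And>i. i \<in> I \<Longrightarrow> finite (A i)" "\<And>x. f x \<ge> 0"
  shows "(\<Sum>x\<in>(\<Union>i\<in>I. A i). f x) \<le> (\<Sum>i\<in>I. \<Sum>x\<in>A i. f x)"
proof -
  have "(\<Union>i\<in>I. A i) = snd ` Sigma I A" by force
  then have "(\<Sum>x\<in>(\<Union>i\<in>I. A i). f x) \<le> (\<Sum>p\<in>Sigma I A. (f \<circ> snd) p)"
    using assms by (simp only:) (rule sum_image_le, auto)
  also have "\<dots> = (\<Sum>i\<in>I. \<Sum>x\<in>A i. f x)"
    using assms by (simp add: sum.Sigma case_prod_unfold)
  finally show ?thesis .
qed

definition bubble :: "nat \<Rightarrow> real \<Rightarrow> real" where
  "bubble N z = (\<Sum>y\<in>hypercube N - {origin}. (two_point N z origin y)\<^sup>2)"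

lemma bubble_shift:
  assumes "v \<in> hypercube N"
  shows "(\<Sum>y\<in>hypercube N - {v}. (two_point N z v y)\<^sup>2) = bubble N z"
proof -
  have "(\<Sum>y\<in>hypercube N - {origin}. (two_point N z v (shift v y))\<^sup>2) =
      (\<Sum>y\<in>hypercube N - {v}. (two_point N z v y)\<^sup>2)"
    by (rule sum.reindex_bij_witness[of _ "shift v" "shift v"])
       (auto simp: shift_in_hypercube assms, (metis shift_origin shift_self shift_shift)+)
  moreover have "two_point N z v (shift v y) = two_point N z origin y" for y
    using two_point_shift[OF assms, where x = origin] by simp
  ultimately show ?thesis by (simp add: bubble_def)
qed

lemma gf_disjoint_le:
  assumes "z \<ge> 0" "v \<in> hypercube N"
  shows "gf_disjoint N z v \<le> (susceptibility N z)\<^sup>2"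
proof -
  have "gf_disjoint N z v \<le> (\<Sum>(a, b)\<in>saws N UNIV v \<times> saws N UNIV v. weight z a * weight z b)"
    unfolding gf_disjoint_def by (rule sum_mono2) (auto simp: weight_nonneg assms)
  also have "\<dots> = (gf N z UNIV v)\<^sup>2"
    by (simp add: gf_def power2_eq_square sum_product sum.cartesian_product)
  finally show ?thesis by (simp add: gf_UNIV[OF assms(2)] susceptibility_eq_gf)
qed

text \<open>Pairs of arms that meet at some \<open>y\<close> other than \<open>v\<close> are removed
  by a union bound over \<open>y\<close>. The arms through \<open>y\<close> have total weight at
  most \<open>two_point N z v y\<close> times the susceptibility; squaring and summing gives the
  bubble.\<close>

lemma gf_disjoint_ge:
  assumes z: "z \<ge> 0" and v: "v \<in> hypercube N"
  shows "gf_disjoint N z v \<ge> (1 - bubble N z) * (susceptibility N z)\<^sup>2"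
proof -
  let ?S = "saws N UNIV v"
  let ?w = "\<lambda>(a, b). weight z a * weight z b"
  let ?through = "\<lambda>y. {a \<in> ?S. y \<in> set a}"
  let ?chi = "susceptibility N z"
  define D where "D = {(a, b) \<in> ?S \<times> ?S. set a \<inter> set b = {v}}"
  define U where "U = (\<Union>y\<in>hypercube N - {v}. ?through y \<times> ?through y)"
  have fin: "finite D" "finite U"
    by (rule finite_subset[of _ "?S \<times> ?S"]; force simp: D_def U_def)+
  have w: "?w p \<ge> 0" for p
    by (cases p) (simp add: weight_nonneg z)
  have chi: "gf N z UNIV y = ?chi" if "y \<in> hypercube N" for y
    using gf_UNIV[OF that] by (simp add: susceptibility_eq_gf)
  have sub: "?S \<times> ?S \<subseteq> D \<union> U"
  proof
    fix p assume "p \<in> ?S \<times> ?S"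
    then obtain a b where p: "p = (a, b)" "a \<in> ?S" "b \<in> ?S" by blast
    then have "v \<in> set a" "v \<in> set b" "set a \<subseteq> hypercube N"
      using hd_in_set[of a] hd_in_set[of b] by (auto simp: saws_def saw_def)
    then have "p \<in> D" if "p \<notin> U"
      using that p unfolding D_def U_def by blast
    then show "p \<in> D \<union> U" by blast
  qed
  have "?chi\<^sup>2 = sum ?w (?S \<times> ?S)"
    unfolding chi[OF v, symmetric] gf_def
    by (simp only: power2_eq_square sum_product sum.cartesian_product)
  also have "\<dots> \<le> sum ?w (D \<union> U)"
    by (rule sum_mono2[OF _ sub]) (use fin w in auto)
  also have "\<dots> \<le> sum ?w D + sum ?w U"
    using sum.union_inter[OF fin, of ?w] sum_nonneg[of "D \<inter> U" ?w] w by fastforce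
  also have "sum ?w D = gf_disjoint N z v"
    by (simp add: gf_disjoint_def D_def)
  also have "sum ?w U \<le> (\<Sum>y\<in>hypercube N - {v}. sum ?w (?through y \<times> ?through y))"
    unfolding U_def by (rule sum_UNION_le) (use w in \<open>auto simp: finite_hypercube\<close>)
  also have "\<dots> = (\<Sum>y\<in>hypercube N - {v}. (\<Sum>a\<in>?through y. weight z a)\<^sup>2)"
    by (simp add: power2_eq_square sum_product sum.cartesian_product)
  also have "\<dots> \<le> (\<Sum>y\<in>hypercube N - {v}. (two_point N z v y * ?chi)\<^sup>2)"
  proof (intro sum_mono power_mono)
    fix y assume "y \<in> hypercube N - {v}"
    then show "(\<Sum>a\<in>?through y. weight z a) \<le> two_point N z v y * ?chi"
      using sum_weight_via_le[OF z, of N UNIV v y] chi by simp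
  qed (auto intro!: sum_nonneg weight_nonneg z)
  also have "\<dots> = bubble N z * ?chi\<^sup>2"
    by (simp add: power_mult_distrib bubble_shift[OF v] flip: sum_distrib_right)
  finally show ?thesis by (simp add: algebra_simps)
qed

text \<open>By translation invariance every starting point contributes equally to
  \<open>sum_gf_len\<close>, so the bounds on \<open>gf_disjoint\<close> pass to a single
  \<open>gf_len\<close>.\<close>

lemma gf_len_bounds:
  assumes "z \<ge> 0"
  shows "gf_len N z origin \<le> (susceptibility N z)\<^sup>2"
    and "gf_len N z origin \<ge> (1 - bubble N z) * (susceptibility N z)\<^sup>2"
proof -
  have V: "2 ^ N * gf_len N z origin = (\<Sum>v\<in>hypercube N. gf_disjoint N z v)"
  proof -
    have "(\<Sum>x\<in>hypercube N. gf_len N z x) = (\<Sum>x\<in>hypercube N. gf_len N z origin)"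
      by (rule sum.cong[OF refl gf_len_shift])
    then show ?thesis by (simp add: card_hypercube flip: sum_gf_len)
  qed
  have "2 ^ N * gf_len N z origin \<le> 2 ^ N * (susceptibility N z)\<^sup>2"
  proof -
    have "(\<Sum>v\<in>hypercube N. gf_disjoint N z v) \<le> (\<Sum>v\<in>hypercube N. (susceptibility N z)\<^sup>2)"
      by (rule sum_mono) (rule gf_disjoint_le[OF assms])
    then show ?thesis unfolding V by (simp add: card_hypercube)
  qed
  then show "gf_len N z origin \<le> (susceptibility N z)\<^sup>2" by simp
  have "2 ^ N * ((1 - bubble N z) * (susceptibility N z)\<^sup>2) \<le> 2 ^ N * gf_len N z origin"
  proof -
    have "(\<Sum>v\<in>hypercube N. (1 - bubble N z) * (susceptibility N z)\<^sup>2) \<le> (\<Sum>v\<in>hypercube N. gf_disjoint N z v)"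
      by (rule sum_mono) (rule gf_disjoint_ge[OF assms])
    then show ?thesis unfolding V by (simp add: card_hypercube)
  qed
  then show "gf_len N z origin \<ge> (1 - bubble N z) * (susceptibility N z)\<^sup>2" by simp
qed

section \<open>Simple random walk on the hypercube\<close>

definition nbr_sum :: "nat \<Rightarrow> ((nat \<Rightarrow> bit) \<Rightarrow> real) \<Rightarrow> (nat \<Rightarrow> bit) \<Rightarrow> real" where
  "nbr_sum N f x = (\<Sum>i<N. f (flip i x))"

text \<open>The characters of the group \<open>Z_2^N\<close>, indexed by subsets of
  \<open>{..<N}\<close>.\<close>

definition walsh :: "nat set \<Rightarrow> (nat \<Rightarrow> bit) \<Rightarrow> real" where
  "walsh S x = (\<Prod>i\<in>S. if x i = 1 then -1 else 1)"

text \<open>On the cube, the number of \<open>n\<close>-step nearest-neighbour walks from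
  \<open>x\<close> to \<open>y\<close>, that is, an entry of the \<open>n\<close>-th power of the
  adjacency operator, written in the eigenbasis of characters; \<open>walk_kernel_0\<close> and
  \<open>nbr_sum_walk_kernel\<close> confirm this.\<close>

definition walk_kernel :: "nat \<Rightarrow> nat \<Rightarrow> (nat \<Rightarrow> bit) \<Rightarrow> (nat \<Rightarrow> bit) \<Rightarrow> real" where
  "walk_kernel N n x y =
     (\<Sum>S\<in>Pow {..<N}. (real N - 2 * real (card S)) ^ n * walsh S x * walsh S y) / 2 ^ N"

text \<open>Expectation over a uniformly random set of coordinates; for functions of
  \<open>card S\<close>, the normalised trace.\<close>

definition mean :: "nat \<Rightarrow> (nat \<Rightarrow> real) \<Rightarrow> real" where
  "mean N F = (\<Sum>S\<in>Pow {..<N}. F (card S)) / 2 ^ N"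

text \<open>Eigenvalue of the adjacency operator divided by \<open>N\<close>, on a character with
  \<open>card S = c\<close>.\<close>

definition eigval :: "nat \<Rightarrow> nat \<Rightarrow> real" where
  "eigval N c = 1 - 2 * real c / real N"

lemma sum_Pow_Suc:
  fixes F :: "nat set \<Rightarrow> real"
  shows "(\<Sum>S\<in>Pow {..<Suc N}. F S) = (\<Sum>S\<in>Pow {..<N}. F S) + (\<Sum>S\<in>Pow {..<N}. F (insert N S))"
proof -
  have "inj_on (insert N) (Pow {..<N})"
    by (auto simp: inj_on_def)
  moreover have "Pow {..<N} \<inter> insert N ` Pow {..<N} = {}"
    by auto
  ultimately show ?thesis
    unfolding lessThan_Suc Pow_insert
    by (subst sum.union_disjoint) (auto simp: sum.reindex)
qed

lemma walsh_flip:
  assumes "finite S"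
  shows "walsh S (flip i x) = (if i \<in> S then - walsh S x else walsh S x)"
proof (cases "i \<in> S")
  case True
  have r: "walsh S y = (if y i = 1 then -1 else 1) * (\<Prod>j\<in>S - {i}. if y j = 1 then -1 else 1)" for y
    unfolding walsh_def by (rule prod.remove[OF assms True])
  have "(\<Prod>j\<in>S - {i}. if flip i x j = 1 then -1 else 1 :: real) = (\<Prod>j\<in>S - {i}. if x j = 1 then -1 else 1)"
    by (rule prod.cong) (auto simp: flip_def)
  moreover have "(if flip i x i = 1 then -1 else 1) = - (if x i = 1 then -1 else 1 :: real)"
    by (cases "x i") (auto simp: flip_def)
  ultimately show ?thesis using True r[of "flip i x"] r[of x] by (simp only: if_True)
next
  case False
  then show ?thesis unfolding walsh_def by (auto intro!: prod.cong simp: flip_def)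
qed

text \<open>Flipping a coordinate in \<open>S\<close> changes the sign and flipping another does
  not: \<open>N - card S\<close> plus signs against \<open>card S\<close> minus signs.\<close>

lemma nbr_sum_walsh:
  assumes "S \<subseteq> {..<N}"
  shows "nbr_sum N (walsh S) x = (real N - 2 * real (card S)) * walsh S x"
proof -
  have fin: "finite S" using assms finite_subset by blast
  have "card ({..<N} - S) = N - card S" "card S \<le> N"
    using assms card_mono[OF _ assms] by (auto simp: card_Diff_subset fin)
  moreover have "{..<N} \<inter> {i. i \<in> S} = S" "{..<N} \<inter> - {i. i \<in> S} = {..<N} - S"
    using assms by auto
  ultimately show ?thesis
    by (simp add: nbr_sum_def walsh_flip[OF fin] sum.If_cases of_nat_diff algebra_simps)
qed

lemma walsh_mult_self: "walsh S x * walsh S x = 1"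
  unfolding walsh_def by (subst prod.distrib[symmetric]) (auto intro!: prod.neutral)

lemma abs_walsh: "\<bar>walsh S x\<bar> = 1"
  unfolding walsh_def abs_prod by (rule prod.neutral) auto

text \<open>Orthogonality in product form: a coordinate where \<open>x\<close> and \<open>y\<close>
  differ contributes the factor 0.\<close>

lemma sum_walsh_mult: "(\<Sum>S\<in>Pow {..<N}. walsh S x * walsh S y) =
    (\<Prod>i<N. 1 + (if x i = 1 then -1 else 1) * (if y i = 1 then -1 else 1))"
proof (induction N)
  case 0
  then show ?case by (simp add: walsh_def)
next
  case (Suc N)
  have "walsh (insert N S) u = (if u N = 1 then -1 else 1) * walsh S u" if "S \<in> Pow {..<N}" for S u
  proof -
    have "finite S" "N \<notin> S" using that finite_subset[of S "{..<N}"] by auto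
    then show ?thesis unfolding walsh_def by (rule prod.insert)
  qed
  then have "(\<Sum>S\<in>Pow {..<N}. walsh (insert N S) x * walsh (insert N S) y) =
     (\<Sum>S\<in>Pow {..<N}. (if x N = 1 then -1 else 1) * (if y N = 1 then -1 else 1) * (walsh S x * walsh S y))"
    by (intro sum.cong) auto
  also have "\<dots> = (if x N = 1 then -1 else 1) * (if y N = 1 then -1 else 1) * (\<Sum>S\<in>Pow {..<N}. walsh S x * walsh S y)"
    by (rule sum_distrib_left[symmetric])
  finally show ?case
    unfolding sum_Pow_Suc prod.lessThan_Suc Suc by (simp only: ring_distribs mult_1_left mult_ac)
qed

lemma walk_kernel_0:
  assumes "x \<in> hypercube N" "y \<in> hypercube N"
  shows "walk_kernel N 0 x y = of_bool (x = y)"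
proof (cases "x = y")
  case True
  then show ?thesis by (simp add: walk_kernel_def walsh_mult_self card_Pow)
next
  case False
  then obtain i where i: "x i \<noteq> y i" by auto
  then have "i < N" using assms by (auto simp: hypercube_def) (metis not_le)
  moreover have "1 + (if x i = 1 then -1 else 1) * (if y i = 1 then -1 else 1) = (0::real)"
    using i by (cases "x i"; cases "y i") auto
  ultimately have "(\<Prod>i<N. 1 + (if x i = 1 then -1 else 1) * (if y i = 1 then -1 else 1)) = (0::real)"
    by (intro prod_zero bexI[of _ i]) auto
  then show ?thesis using False by (simp add: walk_kernel_def sum_walsh_mult)
qed

lemma nbr_sum_walk_kernel: "nbr_sum N (\<lambda>u. walk_kernel N n u y) x = walk_kernel N (Suc n) x y"
proof -
  let ?e = "\<lambda>S. real N - 2 * real (card S)"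
  have "nbr_sum N (\<lambda>u. walk_kernel N n u y) x =
      (\<Sum>S\<in>Pow {..<N}. \<Sum>i<N. ?e S ^ n * walsh S (flip i x) * walsh S y) / 2 ^ N"
    unfolding nbr_sum_def walk_kernel_def
    by (subst sum.swap) (simp add: sum_divide_distrib)
  also have "(\<Sum>S\<in>Pow {..<N}. \<Sum>i<N. ?e S ^ n * walsh S (flip i x) * walsh S y) =
      (\<Sum>S\<in>Pow {..<N}. ?e S ^ n * nbr_sum N (walsh S) x * walsh S y)"
    by (simp add: nbr_sum_def sum_distrib_left sum_distrib_right)
  also have "\<dots> = (\<Sum>S\<in>Pow {..<N}. ?e S ^ Suc n * walsh S x * walsh S y)"
    by (intro sum.cong refl) (simp add: nbr_sum_walsh mult_ac)
  finally show ?thesis by (simp add: walk_kernel_def)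
qed

lemma walk_kernel_sym: "walk_kernel N n x y = walk_kernel N n y x"
  by (simp add: walk_kernel_def mult_ac)

lemma nbr_sum_cong:
  "x \<in> hypercube N \<Longrightarrow> (\<And>u. u \<in> hypercube N \<Longrightarrow> f u = g u) \<Longrightarrow> nbr_sum N f x = nbr_sum N g x"
  by (auto simp: nbr_sum_def intro!: sum.cong)

lemma nbr_sum_mono:
  "x \<in> hypercube N \<Longrightarrow> (\<And>u. u \<in> hypercube N \<Longrightarrow> f u \<le> g u) \<Longrightarrow> nbr_sum N f x \<le> nbr_sum N g x"
  by (auto simp: nbr_sum_def intro!: sum_mono)

lemma nbr_sum_iterate:
  assumes "x \<in> hypercube N"
  shows "(nbr_sum N ^^ n) f x = (\<Sum>y\<in>hypercube N. walk_kernel N n x y * f y)"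
  using assms
proof (induction n arbitrary: x)
  case 0
  have "(\<Sum>y\<in>hypercube N. walk_kernel N 0 x y * f y) = (\<Sum>y\<in>hypercube N. if y = x then f y else 0)"
    using 0 by (intro sum.cong) (auto simp: walk_kernel_0)
  then show ?case using 0 by (simp add: finite_hypercube)
next
  case (Suc n)
  have "(nbr_sum N ^^ Suc n) f x = nbr_sum N (\<lambda>u. \<Sum>y\<in>hypercube N. walk_kernel N n u y * f y) x"
    unfolding funpow.simps o_apply by (rule nbr_sum_cong[OF Suc.prems Suc.IH])
  also have "\<dots> = (\<Sum>y\<in>hypercube N. \<Sum>i<N. walk_kernel N n (flip i x) y * f y)"
    unfolding nbr_sum_def by (rule sum.swap)
  also have "\<dots> = (\<Sum>y\<in>hypercube N. walk_kernel N (Suc n) x y * f y)"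
    by (simp only: nbr_sum_walk_kernel[symmetric]) (simp add: nbr_sum_def sum_distrib_right)
  finally show ?case .
qed

lemma nbr_sum_iterate_walk_kernel: "(nbr_sum N ^^ n) (\<lambda>u. walk_kernel N m u y) = (\<lambda>u. walk_kernel N (n + m) u y)"
proof (induction n)
  case (Suc n)
  then show ?case by (intro ext) (simp add: nbr_sum_walk_kernel)
qed simp

text \<open>Chapman-Kolmogorov, with the symmetry of the kernel turning one factor around.\<close>

lemma sum_walk_kernel_mult:
  assumes "y \<in> hypercube N"
  shows "(\<Sum>x\<in>hypercube N. walk_kernel N n x y * walk_kernel N m x y) = walk_kernel N (n + m) y y"
  using nbr_sum_iterate[OF assms, of n "\<lambda>u. walk_kernel N m u y"]
  by (simp add: nbr_sum_iterate_walk_kernel walk_kernel_sym[of N n y])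

lemma eigval_mult: "N \<ge> 1 \<Longrightarrow> real N - 2 * real c = real N * eigval N c"
  by (simp add: eigval_def field_simps)

lemma walk_kernel_diag:
  assumes "N \<ge> 1"
  shows "walk_kernel N n x x = real N ^ n * mean N (\<lambda>c. eigval N c ^ n)"
  by (simp add: walk_kernel_def mean_def eigval_mult[OF assms] power_mult_distrib sum_distrib_left
      mult.assoc walsh_mult_self)

lemma walk_kernel_le:
  assumes "N \<ge> 1"
  shows "\<bar>walk_kernel N n x y\<bar> \<le> real N ^ n * mean N (\<lambda>c. \<bar>eigval N c\<bar> ^ n)"
proof -
  have "\<bar>\<Sum>S\<in>Pow {..<N}. (real N - 2 * real (card S)) ^ n * walsh S x * walsh S y\<bar>
      \<le> (\<Sum>S\<in>Pow {..<N}. \<bar>(real N - 2 * real (card S)) ^ n * walsh S x * walsh S y\<bar>)"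
    by (rule sum_abs)
  also have "\<dots> = real N ^ n * (\<Sum>S\<in>Pow {..<N}. \<bar>eigval N (card S)\<bar> ^ n)"
    by (simp add: eigval_mult[OF assms] abs_mult abs_walsh power_mult_distrib power_abs sum_distrib_left)
  finally show ?thesis
    by (simp add: walk_kernel_def mean_def divide_right_mono)
qed

text \<open>The signs in the spectral sum hide this; it follows from the recursion that makes the
  kernel a count of walks.\<close>

lemma walk_kernel_nonneg:
  assumes "x \<in> hypercube N" "y \<in> hypercube N"
  shows "walk_kernel N n x y \<ge> 0"
  using assms(1)
proof (induction n arbitrary: x)
  case (Suc n)
  then show ?case
    unfolding nbr_sum_walk_kernel[symmetric] nbr_sum_def by (auto intro!: sum_nonneg)
qed (simp add: walk_kernel_0 assms)

section \<open>Moments and tails of the eigenvalues\<close>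

lemma mean_mono: "(\<And>c. c \<le> N \<Longrightarrow> F c \<le> G c) \<Longrightarrow> mean N F \<le> mean N G"
  unfolding mean_def
  by (intro divide_right_mono sum_mono) (auto dest: card_mono[rotated])

lemma mean_add: "mean N (\<lambda>c. F c + G c) = mean N F + mean N G"
  by (simp add: mean_def sum.distrib add_divide_distrib)

lemma mean_cmult: "mean N (\<lambda>c. a * F c) = a * mean N F"
  by (simp add: mean_def sum_distrib_left)

lemma mean_const: "mean N (\<lambda>c. a) = a"
  by (simp add: mean_def card_Pow)

lemma mean_sum: "mean N (\<lambda>c. \<Sum>i\<in>I. F i c) = (\<Sum>i\<in>I. mean N (F i))"
  unfolding mean_def by (subst sum.swap) (simp add: sum_divide_distrib)

text \<open>Up to the scaling by \<open>N\<close>, the eigenvalues are distributed as a sum of \<open>N\<close> random signs.\<close>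

lemma sum_signs_Suc:
  fixes g :: "real \<Rightarrow> real"
  shows "(\<Sum>S\<in>Pow {..<Suc N}. g (real (Suc N) - 2 * real (card S))) =
    (\<Sum>S\<in>Pow {..<N}. g (real N - 2 * real (card S) + 1)) +
    (\<Sum>S\<in>Pow {..<N}. g (real N - 2 * real (card S) - 1))"
proof -
  have "card (insert N S) = Suc (card S)" if "S \<in> Pow {..<N}" for S
    using that finite_subset[of S "{..<N}"] by (subst card_insert_disjoint) auto
  then have "(\<Sum>S\<in>Pow {..<N}. g (real (Suc N) - 2 * real (card (insert N S)))) =
      (\<Sum>S\<in>Pow {..<N}. g (real N - 2 * real (card S) - 1))"
    by (intro sum.cong refl) (simp add: algebra_simps)
  moreover have "(\<Sum>S\<in>Pow {..<N}. g (real (Suc N) - 2 * real (card S))) =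
      (\<Sum>S\<in>Pow {..<N}. g (real N - 2 * real (card S) + 1))"
    by (intro sum.cong refl) (simp add: algebra_simps)
  ultimately show ?thesis unfolding sum_Pow_Suc by simp
qed

definition sum_signs :: "nat \<Rightarrow> (real \<Rightarrow> real) \<Rightarrow> real" where
  "sum_signs N g = (\<Sum>S\<in>Pow {..<N}. g (real N - 2 * real (card S)))"

text \<open>Induction on \<open>N\<close>, splitting on the added sign: \<open>g x\<close> becomes
  \<open>g (x + 1) + g (x - 1)\<close>. The values carry the total mass
  \<open>2 ^ N\<close>.\<close>

lemma sum_signs_moments:
  shows "sum_signs N (\<lambda>x. x) = 0" "sum_signs N (\<lambda>x. x ^ 2) = real N * 2 ^ N" "sum_signs N (\<lambda>x. x ^ 3) = 0"
    "sum_signs N (\<lambda>x. x ^ 4) = (3 * real N ^ 2 - 2 * real N) * 2 ^ N"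
proof -
  have R0: "sum_signs N (\<lambda>x. 1) = 2 ^ N" for N by (simp add: sum_signs_def card_Pow)
  have Suc: "sum_signs (Suc N) g = sum_signs N (\<lambda>x. g (x + 1) + g (x - 1))" for N g
    unfolding sum_signs_def sum_signs_Suc by (simp add: sum.distrib)
  have lin: "sum_signs N (\<lambda>x. a * f x + b * g x) = a * sum_signs N f + b * sum_signs N g" for N a b f g
    by (simp add: sum_signs_def sum.distrib sum_distrib_left)
  have lin3: "sum_signs N (\<lambda>x. a * f x + b * g x + c * h x) = a * sum_signs N f + b * sum_signs N g + c * sum_signs N h" for N a b c f g h
    by (simp add: sum_signs_def sum.distrib sum_distrib_left)
  have 1: "sum_signs N (\<lambda>x. x) = 0" for N
  proof (induction N)
    case IH: (Suc N)
    have "sum_signs (Suc N) (\<lambda>x. x) = sum_signs N (\<lambda>x. 2 * x + 0 * 1)" unfolding Suc by simp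
    then show ?case using IH.IH lin[of N 2 "\<lambda>x. x" 0 "\<lambda>x. 1"] by simp
  qed (simp add: sum_signs_def)
  have 2: "sum_signs N (\<lambda>x. x ^ 2) = real N * 2 ^ N" for N
  proof (induction N)
    case IH: (Suc N)
    have "sum_signs (Suc N) (\<lambda>x. x ^ 2) = sum_signs N (\<lambda>x. 2 * x ^ 2 + 2 * 1)"
      unfolding Suc by (intro arg_cong[of _ _ "sum_signs N"] ext) (simp add: power2_eq_square algebra_simps)
    then show ?case using IH.IH lin[of N 2 "\<lambda>x. x ^ 2" 2 "\<lambda>x. 1"] R0 by (simp add: algebra_simps)
  qed (simp add: sum_signs_def)
  have 3: "sum_signs N (\<lambda>x. x ^ 3) = 0" for N
  proof (induction N)
    case IH: (Suc N)
    have "sum_signs (Suc N) (\<lambda>x. x ^ 3) = sum_signs N (\<lambda>x. 2 * x ^ 3 + 6 * x)"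
      unfolding Suc by (intro arg_cong[of _ _ "sum_signs N"] ext) (simp add: power3_eq_cube algebra_simps)
    then show ?case using IH.IH lin[of N 2 "\<lambda>x. x ^ 3" 6 "\<lambda>x. x"] 1[of N] by simp
  qed (simp add: sum_signs_def)
  have 4: "sum_signs N (\<lambda>x. x ^ 4) = (3 * real N ^ 2 - 2 * real N) * 2 ^ N" for N
  proof (induction N)
    case IH: (Suc N)
    have "sum_signs (Suc N) (\<lambda>x. x ^ 4) = sum_signs N (\<lambda>x. 2 * x ^ 4 + 12 * x ^ 2 + 2 * 1)"
      unfolding Suc
      by (intro arg_cong[of _ _ "sum_signs N"] ext) (simp add: power4_eq_xxxx power2_eq_square algebra_simps)
    then have "sum_signs (Suc N) (\<lambda>x. x ^ 4) = 2 * ((3 * real N ^ 2 - 2 * real N) * 2 ^ N) + 12 * (real N * 2 ^ N) + 2 * 2 ^ N"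
      using IH.IH lin3[of N 2 "\<lambda>x. x ^ 4" 12 "\<lambda>x. x ^ 2" 2 "\<lambda>x. 1"] R0 2 by simp
    then show ?case by (simp add: power2_eq_square algebra_simps)
  qed (simp add: sum_signs_def)
  show "sum_signs N (\<lambda>x. x) = 0" "sum_signs N (\<lambda>x. x ^ 2) = real N * 2 ^ N" "sum_signs N (\<lambda>x. x ^ 3) = 0"
    "sum_signs N (\<lambda>x. x ^ 4) = (3 * real N ^ 2 - 2 * real N) * 2 ^ N"
    by (fact 1 2 3 4)+
qed

lemma mean_eigval:
  assumes "N \<ge> 1"
  shows "mean N (\<lambda>c. eigval N c) = 0" "mean N (\<lambda>c. eigval N c ^ 2) = 1 / real N"
    "mean N (\<lambda>c. eigval N c ^ 3) = 0" "mean N (\<lambda>c. eigval N c ^ 4) \<le> 3 / real N ^ 2"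
proof -
  have e: "eigval N c = (real N - 2 * real c) / real N" for c
    using assms by (simp add: eigval_def field_simps)
  have m: "mean N (\<lambda>c. eigval N c ^ k) =
      (\<Sum>S\<in>Pow {..<N}. (real N - 2 * real (card S)) ^ k) / (real N ^ k * 2 ^ N)" for k
    unfolding mean_def e power_divide by (simp add: sum_divide_distrib)
  note s = sum_signs_moments[of N, unfolded sum_signs_def]
  show "mean N (\<lambda>c. eigval N c) = 0" using m[of 1] s(1) by simp
  show "mean N (\<lambda>c. eigval N c ^ 2) = 1 / real N"
    unfolding m s(2) using assms by (simp add: power2_eq_square)
  show "mean N (\<lambda>c. eigval N c ^ 3) = 0" unfolding m s(3) by simp
  have "mean N (\<lambda>c. eigval N c ^ 4) = (3 * real N ^ 2 - 2 * real N) / real N ^ 4"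
    unfolding m s(4) by simp
  also have "\<dots> \<le> (3 * real N ^ 2) / real N ^ 4"
    by (intro divide_right_mono) auto
  also have "\<dots> = 3 / real N ^ 2"
    using assms by (simp add: power4_eq_xxxx power2_eq_square)
  finally show "mean N (\<lambda>c. eigval N c ^ 4) \<le> 3 / real N ^ 2" .
qed

lemma sum_binomial_Pow:
  fixes a b :: real
  shows "(\<Sum>S\<in>Pow {..<N}. a ^ card S * b ^ (N - card S)) = (a + b) ^ N"
proof (induction N)
  case (Suc N)
  have 1: "card (insert N S) = Suc (card S)" "card S \<le> N" if "S \<in> Pow {..<N}" for S
    using that finite_subset[of S "{..<N}"] card_mono[of "{..<N}" S]
    by (auto intro!: card_insert_disjoint)
  have "(\<Sum>S\<in>Pow {..<N}. a ^ card S * b ^ (Suc N - card S)) = (\<Sum>S\<in>Pow {..<N}. b * (a ^ card S * b ^ (N - card S)))"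
    by (intro sum.cong refl) (simp add: Suc_diff_le 1)
  moreover have "(\<Sum>S\<in>Pow {..<N}. a ^ card (insert N S) * b ^ (Suc N - card (insert N S))) =
      (\<Sum>S\<in>Pow {..<N}. a * (a ^ card S * b ^ (N - card S)))"
    by (intro sum.cong refl) (simp add: 1)
  ultimately show ?case
    unfolding sum_Pow_Suc by (simp add: Suc sum_distrib_left[symmetric] algebra_simps)
qed simp

text \<open>Chernoff bound for a normalised sum of \<open>N\<close> signs to exceed
  \<open>1 / 2\<close> in absolute value; see \<open>mean_tail\<close>.\<close>

definition tail :: "nat \<Rightarrow> real" where
  "tail N = 2 * exp (- real N / 10)"

lemma chernoff_constant: "(5 / 4) ^ N / 2 powr (real N / 2) \<le> exp (- real N / 10)"
proof (rule power2_le_imp_le)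
  have "2 powr (real N / 2) * 2 powr (real N / 2) = (2 :: real) ^ N"
    by (simp add: powr_realpow flip: powr_add)
  then have "((5 / 4) ^ N / 2 powr (real N / 2))\<^sup>2 = (25 / 32 :: real) ^ N"
    by (simp add: power2_eq_square flip: power_mult_distrib power_divide)
  \<comment> \<open>\<open>exp (- 1 / 5)\<close> is at least \<open>4 / 5\<close>, which is above
    \<open>25 / 32\<close>.\<close>
  also have "\<dots> \<le> exp (- 1 / 5) ^ N"
    using exp_ge_add_one_self[of "- 1 / 5 :: real"] by (intro power_mono) auto
  also have "\<dots> = (exp (- real N / 10))\<^sup>2"
    by (simp flip: exp_of_nat_mult)
  finally show "((5 / 4) ^ N / 2 powr (real N / 2))\<^sup>2 \<le> (exp (- real N / 10))\<^sup>2" .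
qed simp

text \<open>Exponential Markov inequality with base 2. With \<open>X = N - 2 * c\<close>,
  \<open>?W c\<close> is \<open>2 powr X + 2 powr (- X)\<close>, which is at least
  \<open>2 powr (N / 2)\<close> on the event; by the binomial theorem each summand has mean
  \<open>(5 / 4) ^ N\<close>.\<close>

lemma mean_tail:
  assumes "N \<ge> 1"
  shows "mean N (\<lambda>c. of_bool (\<bar>eigval N c\<bar> > 1 / 2)) \<le> tail N"
proof -
  let ?W = "\<lambda>c. (1 / 2) ^ c * 2 ^ (N - c) + 2 ^ c * (1 / 2) ^ (N - c) :: real"
  have "of_bool (\<bar>eigval N c\<bar> > 1 / 2) \<le> (1 / 2 powr (real N / 2)) * ?W c" if "c \<le> N" for c
  proof (cases "\<bar>eigval N c\<bar> > 1 / 2")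
    case True
    have w1: "(1 / 2) ^ c * 2 ^ (N - c) = 2 powr (real N - 2 * real c)"
      using that by (simp add: powr_diff powr_realpow[symmetric] power_one_over of_nat_diff field_simps flip: powr_add)
    have w2: "2 ^ c * (1 / 2) ^ (N - c) = 2 powr (2 * real c - real N)"
      using that by (simp add: powr_diff powr_realpow[symmetric] power_one_over of_nat_diff field_simps flip: powr_add)
    have "real N - 2 * real c \<ge> real N / 2 \<or> 2 * real c - real N \<ge> real N / 2"
      using True assms by (auto simp: eigval_def field_simps abs_if split: if_splits)
    then have "?W c \<ge> 2 powr (real N / 2)"
      unfolding w1 w2 using powr_ge_zero[of 2 "real N - 2 * real c"] powr_ge_zero[of 2 "2 * real c - real N"]
        powr_mono[of "real N / 2" "real N - 2 * real c" 2] powr_mono[of "real N / 2" "2 * real c - real N" 2]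
      by linarith
    then show ?thesis using True by (simp add: field_simps)
  qed auto
  then have "mean N (\<lambda>c. of_bool (\<bar>eigval N c\<bar> > 1 / 2)) \<le> mean N (\<lambda>c. (1 / 2 powr (real N / 2)) * ?W c)"
    by (rule mean_mono)
  also have "\<dots> = (1 / 2 powr (real N / 2)) * ((5 / 2) ^ N + (5 / 2) ^ N) / 2 ^ N"
    using sum_binomial_Pow[of "1 / 2" 2 N] sum_binomial_Pow[of 2 "1 / 2" N]
    unfolding mean_cmult by (simp add: mean_def sum.distrib)
  also have "\<dots> = 2 * ((5 / 4) ^ N / 2 powr (real N / 2))"
    by (simp add: power_divide field_simps flip: power_mult_distrib)
  also have "\<dots> \<le> tail N"
    unfolding tail_def by (intro mult_left_mono chernoff_constant) simp
  finally show ?thesis .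
qed

lemma abs_eigval_le_1: "N \<ge> 1 \<Longrightarrow> c \<le> N \<Longrightarrow> \<bar>eigval N c\<bar> \<le> 1"
  by (auto simp: eigval_def abs_le_iff field_simps)

text \<open>Mixing: since \<open>1 - u \<le> exp (- u)\<close>, the power is at most
  \<open>q ^ c\<close> or \<open>q ^ (N - c)\<close>, according to the sign of the eigenvalue. The
  binomial theorem leaves \<open>2 * (1 + q) ^ N / 2 ^ N\<close>, and
  \<open>(1 + q) ^ N \<le> exp 1 \<le> 3\<close> because \<open>N * q \<le> 1\<close>.\<close>

lemma mean_eigval_power_le:
  assumes N: "N \<ge> 1" and T: "real N * exp (- 2 * real T / real N) \<le> 1"
  shows "mean N (\<lambda>c. \<bar>eigval N c\<bar> ^ T) \<le> 6 / 2 ^ N"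
proof -
  define q where "q = exp (- 2 * real T / real N)"
  have q: "q > 0" "real N * q \<le> 1" using T by (simp_all add: q_def)
  have small: "(1 - 2 * real j / real N) ^ T \<le> q ^ j" if "0 \<le> 1 - 2 * real j / real N" for j
  proof -
    have "(1 - 2 * real j / real N) ^ T \<le> exp (- 2 * real j / real N) ^ T"
      using that exp_ge_add_one_self[of "- 2 * real j / real N"] by (intro power_mono) auto
    also have "\<dots> = q ^ j" by (simp add: q_def mult_ac flip: exp_of_nat_mult)
    finally show ?thesis .
  qed
  have "\<bar>eigval N c\<bar> ^ T \<le> q ^ c * 1 ^ (N - c) + 1 ^ c * q ^ (N - c)" if "c \<le> N" for c
  proof (cases "eigval N c \<ge> 0")
    case True
    then have "\<bar>eigval N c\<bar> ^ T \<le> q ^ c" using small[of c] by (simp add: eigval_def)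
    moreover have "0 \<le> q ^ (N - c)" using q by simp
    ultimately show ?thesis by simp
  next
    case False
    have "- eigval N c = 1 - 2 * real (N - c) / real N"
      using that N by (simp add: eigval_def of_nat_diff field_simps)
    then have "\<bar>eigval N c\<bar> ^ T \<le> q ^ (N - c)" using False small[of "N - c"] by simp
    moreover have "0 \<le> q ^ c" using q by simp
    ultimately show ?thesis by simp
  qed
  then have "mean N (\<lambda>c. \<bar>eigval N c\<bar> ^ T) \<le> mean N (\<lambda>c. q ^ c * 1 ^ (N - c) + 1 ^ c * q ^ (N - c))"
    by (rule mean_mono)
  also have "\<dots> = 2 * (1 + q) ^ N / 2 ^ N"
    using sum_binomial_Pow[of q 1 N] sum_binomial_Pow[of 1 q N]
    by (simp add: mean_def sum.distrib add.commute)
  also have "(1 + q) ^ N \<le> exp q ^ N"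
    using q by (intro power_mono exp_ge_add_one_self) auto
  also have "exp q ^ N = exp (real N * q)" by (simp add: exp_of_nat_mult)
  also have "\<dots> \<le> exp 1" using q by simp
  also have "\<dots> \<le> (3::real)" using exp_le by simp
  finally show ?thesis by (simp add: divide_right_mono)
qed

section \<open>Truncated Green function\<close>

lemma abs_sum_power_le:
  fixes x :: real
  assumes "\<bar>x\<bar> \<le> 1 / 2"
  shows "\<bar>\<Sum>m<k. x ^ m\<bar> \<le> 2"
proof -
  have "\<bar>\<Sum>m<k. x ^ m\<bar> \<le> (\<Sum>m<k. \<bar>x\<bar> ^ m)"
    using sum_abs[of "\<lambda>m. x ^ m" "{..<k}"] by (simp add: power_abs)
  also have "\<dots> \<le> (\<Sum>m<k. (1 / 2) ^ m)"
    using assms by (intro sum_mono power_mono) auto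
  also have "\<dots> \<le> 2" by (simp add: geometric_sum)
  finally show ?thesis .
qed

text \<open>The cube is kept exactly because its mean vanishes. The rest is of fourth order for
  \<open>x\<close> up to \<open>1 / 2\<close> in absolute value; larger \<open>x\<close> cost
  \<open>T\<close> times an indicator of exponentially small mean.\<close>

lemma sum_power_ge3_le:
  fixes x :: real
  assumes "\<bar>x\<bar> \<le> 1" "T \<ge> 3"
  shows "(\<Sum>n\<in>{2..<T}. x ^ Suc n) \<le> x ^ 3 + 2 * x ^ 4 + real T * of_bool (\<bar>x\<bar> > 1 / 2)"
proof (cases "\<bar>x\<bar> > 1 / 2")
  case True
  have "(\<Sum>n\<in>{2..<T}. x ^ Suc n) \<le> (\<Sum>n\<in>{2..<T}. 1)"
  proof (rule sum_mono)
    fix n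
    show "x ^ Suc n \<le> 1" using power_le_one[of "\<bar>x\<bar>" "Suc n"] assms(1) power_abs[of x "Suc n"] by linarith
  qed
  also have "\<dots> \<le> real T" by simp
  \<comment> \<open>This is \<open>x ^ 3 + 2 * x ^ 4\<close>; beyond \<open>1 / 2\<close> in
    absolute value both factors have the sign of \<open>x\<close>.\<close>
  also have "x ^ 3 * (1 + 2 * x) \<ge> 0"
    using True by (cases "x > 0") (auto simp: zero_le_mult_iff power3_eq_cube mult_le_0_iff abs_if split: if_splits)
  ultimately show ?thesis using True by (simp add: power4_eq_xxxx power3_eq_cube algebra_simps)
next
  case False
  obtain k where k: "T = k + 3" using assms(2) by (intro that[of "T - 3"]) simp
  have "(\<Sum>n\<in>{2..<k + 3}. x ^ Suc n) = x ^ 3 + x ^ 4 * (\<Sum>m<k. x ^ m)"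
    by (induction k) (simp_all add: algebra_simps numeral_eq_Suc)
  also have "x ^ 4 * (\<Sum>m<k. x ^ m) \<le> x ^ 4 * 2"
    using abs_sum_power_le[of x k] False by (intro mult_left_mono) auto
  finally show ?thesis using False k by simp
qed

text \<open>Here the linear term is kept exactly, having mean 0; the quadratic term has mean of
  order \<open>1 / N\<close>.\<close>

lemma sum_power_sq_le:
  fixes x :: real
  assumes "\<bar>x\<bar> \<le> 1" "T \<ge> 3"
  shows "(\<Sum>n<T. x ^ n)\<^sup>2 \<le> 1 + 2 * x + 8 * x ^ 2 + (real T ^ 2 + 2) * of_bool (\<bar>x\<bar> > 1 / 2)"
proof (cases "\<bar>x\<bar> > 1 / 2")
  case True
  have "\<bar>\<Sum>n<T. x ^ n\<bar> \<le> (\<Sum>n<T. \<bar>x ^ n\<bar>)"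
    by (rule sum_abs)
  also have "\<dots> \<le> (\<Sum>n<T. 1)"
    using assms by (intro sum_mono) (auto simp: power_abs power_le_one)
  finally have "(\<Sum>n<T. x ^ n)\<^sup>2 \<le> real T ^ 2"
    by (intro abs_le_square_iff[THEN iffD1]) simp
  \<comment> \<open>The \<open>+ 2\<close> beside \<open>T ^ 2\<close> makes up for
    \<open>1 + 2 * x\<close> being negative when \<open>x\<close> is near \<open>-1\<close>.\<close>
  moreover have "1 + 2 * x + 2 \<ge> 0" using assms(1) by (simp add: abs_le_iff)
  moreover have "8 * x ^ 2 \<ge> 0" by simp
  ultimately show ?thesis using True unfolding of_bool_def by (simp only: if_True mult_1_right)
next
  case False
  obtain k where k: "T = k + 2" using assms(2) by (intro that[of "T - 2"]) simp
  define r where "r = (\<Sum>m<k. x ^ m)"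
  have "(\<Sum>n<k + 2. x ^ n) = 1 + x + x ^ 2 * r"
    unfolding r_def by (induction k) (simp_all add: algebra_simps numeral_eq_Suc)
  then have "(\<Sum>n<T. x ^ n)\<^sup>2 = 1 + 2 * x + x ^ 2 * (1 + 2 * r + 2 * (x * r) + (x * r) ^ 2)"
    by (simp add: k power2_eq_square algebra_simps)
  moreover have r: "\<bar>r\<bar> \<le> 2" unfolding r_def using False by (intro abs_sum_power_le) auto
  moreover have xr: "\<bar>x * r\<bar> \<le> 1"
    using mult_mono[of "\<bar>x\<bar>" "1 / 2" "\<bar>r\<bar>" 2] r False by (simp add: abs_mult)
  moreover have "(x * r) ^ 2 \<le> 1" using xr by (simp add: abs_square_le_1)
  \<comment> \<open>The bracket is at most \<open>1 + 4 + 2 + 1\<close>.\<close>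
  ultimately have "x ^ 2 * (1 + 2 * r + 2 * (x * r) + (x * r) ^ 2) \<le> x ^ 2 * 8"
    by (intro mult_left_mono) auto
  then show ?thesis using \<open>(\<Sum>n<T. x ^ n)\<^sup>2 = _\<close> False by simp
qed

lemma sum_mean_eigval_le:
  assumes "N \<ge> 1" "T \<ge> 3"
  shows "(\<Sum>n\<in>{2..<T}. mean N (\<lambda>c. eigval N c ^ Suc n)) \<le> 6 / real N ^ 2 + real T * tail N"
proof -
  have "(\<Sum>n\<in>{2..<T}. mean N (\<lambda>c. eigval N c ^ Suc n)) = mean N (\<lambda>c. \<Sum>n\<in>{2..<T}. eigval N c ^ Suc n)"
    by (rule mean_sum[symmetric])
  also have "\<dots> \<le> mean N (\<lambda>c. eigval N c ^ 3 + 2 * eigval N c ^ 4 + real T * of_bool (\<bar>eigval N c\<bar> > 1 / 2))"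
    by (intro mean_mono sum_power_ge3_le abs_eigval_le_1 assms)
  also have "\<dots> \<le> 0 + 2 * (3 / real N ^ 2) + real T * tail N"
    unfolding mean_add mean_cmult
    using mean_eigval[OF assms(1)] mean_tail[OF assms(1)] by (intro add_mono mult_left_mono) auto
  finally show ?thesis by simp
qed

lemma mean_green_sq_le:
  assumes "N \<ge> 1" "T \<ge> 3"
  shows "mean N (\<lambda>c. (\<Sum>n<T. eigval N c ^ n)\<^sup>2) \<le> 1 + 8 / real N + (real T ^ 2 + 2) * tail N"
proof -
  have "mean N (\<lambda>c. (\<Sum>n<T. eigval N c ^ n)\<^sup>2) \<le>
      mean N (\<lambda>c. 1 + 2 * eigval N c + 8 * eigval N c ^ 2 + (real T ^ 2 + 2) * of_bool (\<bar>eigval N c\<bar> > 1 / 2))"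
    by (intro mean_mono sum_power_sq_le abs_eigval_le_1 assms)
  also have "\<dots> \<le> 1 + 2 * 0 + 8 * (1 / real N) + (real T ^ 2 + 2) * tail N"
    unfolding mean_add mean_cmult mean_const
    using mean_eigval[OF assms(1)] mean_tail[OF assms(1)] by (intro add_mono mult_left_mono) auto
  finally show ?thesis by simp
qed

text \<open>Parseval: on expanding the square, \<open>sum_walk_kernel_mult\<close> turns each
  product into a return count, which \<open>walk_kernel_diag\<close> expresses as a moment.\<close>

lemma sum_green_sq:
  assumes "N \<ge> 1" "y \<in> hypercube N"
  shows "(\<Sum>x\<in>hypercube N. (\<Sum>n<T. walk_kernel N n x y / real N ^ n)\<^sup>2) = mean N (\<lambda>c. (\<Sum>n<T. eigval N c ^ n)\<^sup>2)"
proof -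
  have "(\<Sum>x\<in>hypercube N. (\<Sum>n<T. walk_kernel N n x y / real N ^ n)\<^sup>2) =
      (\<Sum>x\<in>hypercube N. \<Sum>n<T. \<Sum>m<T. walk_kernel N n x y * walk_kernel N m x y / real N ^ (n + m))"
    by (simp add: power2_eq_square sum_product power_add)
  also have "\<dots> = (\<Sum>n<T. \<Sum>m<T. \<Sum>x\<in>hypercube N. walk_kernel N n x y * walk_kernel N m x y / real N ^ (n + m))"
    by (subst sum.swap) (intro sum.cong refl sum.swap)
  also have "\<dots> = (\<Sum>n<T. \<Sum>m<T. mean N (\<lambda>c. eigval N c ^ (n + m)))"
    using assms by (simp add: sum_walk_kernel_mult walk_kernel_diag flip: sum_divide_distrib)
  also have "\<dots> = mean N (\<lambda>c. (\<Sum>n<T. eigval N c ^ n)\<^sup>2)"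
    by (simp add: power2_eq_square sum_product mean_sum power_add)
  finally show ?thesis .
qed

section \<open>Comparison with simple random walk\<close>

abbreviation to_origin :: "nat \<Rightarrow> real \<Rightarrow> (nat \<Rightarrow> bit) \<Rightarrow> real" where
  "to_origin N z x \<equiv> two_point N z x origin"

abbreviation nbr_mass :: "nat \<Rightarrow> real \<Rightarrow> real" where
  "nbr_mass N z \<equiv> nbr_sum N (to_origin N z) origin"

section \<open>One-step inequalities for the two-point function\<close>

lemma susceptibility_ge_1:
  assumes "z \<ge> 0"
  shows "susceptibility N z \<ge> 1"
proof -
  have "real (saw_count N 0) * z ^ 0 \<le> susceptibility N z"
    unfolding susceptibility_def
    using assms by (intro member_le_sum[where f = "\<lambda>n. real (saw_count N n) * z ^ n"]) auto
  then show ?thesis by (simp add: saw_count_0)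
qed

lemma susceptibility_mono:
  assumes "0 \<le> x" "x \<le> y"
  shows "susceptibility N x \<le> susceptibility N y"
  unfolding susceptibility_def using assms by (intro sum_mono mult_left_mono power_mono) auto

text \<open>The susceptibility \<open>chi\<close> is the same from every start, so the first-step
  lower bound reads \<open>chi \<ge> 1 + z * (N - nbr_mass N z) * chi\<close>; this forces
  \<open>1 - z * N + z * nbr_mass N z\<close> to be positive.\<close>

lemma fugacity_less:
  assumes "z \<ge> 0"
  shows "z * real N < 1 + z * nbr_mass N z"
proof -
  let ?chi = "susceptibility N z"
  have "?chi \<ge> 1 + z * (\<Sum>i<N. gf N z UNIV (flip i origin) - to_origin N z (flip i origin) * gf N z UNIV origin)"
    using gf_ge_first_step[OF origin_in_hypercube assms, where N = N and L = UNIV] by (simp add: susceptibility_eq_gf)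
  moreover have "(\<Sum>i<N. gf N z UNIV (flip i origin) - to_origin N z (flip i origin) * gf N z UNIV origin) =
      (\<Sum>i<N. ?chi - to_origin N z (flip i origin) * ?chi)"
  proof (rule sum.cong[OF refl])
    fix i assume "i \<in> {..<N}"
    then have "gf N z UNIV (flip i origin) = gf N z UNIV origin" by (intro gf_UNIV) simp
    then show "gf N z UNIV (flip i origin) - to_origin N z (flip i origin) * gf N z UNIV origin =
        ?chi - to_origin N z (flip i origin) * ?chi"
      by (simp add: susceptibility_eq_gf)
  qed
  moreover have "\<dots> = real N * ?chi - nbr_mass N z * ?chi"
    by (simp add: sum_subtractf nbr_sum_def sum_distrib_right)
  ultimately have "?chi \<ge> 1 + z * (real N * ?chi - nbr_mass N z * ?chi)"
    by (simp only:)
  then have "?chi * (1 - z * real N + z * nbr_mass N z) \<ge> 1"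
    by (simp add: algebra_simps)
  then have "0 < ?chi * (1 - z * real N + z * nbr_mass N z)" by linarith
  then have "0 < 1 - z * real N + z * nbr_mass N z"
    using susceptibility_ge_1[OF assms, of N] by (simp add: zero_less_mult_iff)
  then show ?thesis by simp
qed

lemma to_origin_ge:
  assumes "z \<ge> 0" "i < N"
  shows "to_origin N z (flip i origin) \<ge> z"
proof -
  have "adj N (flip i origin) origin"
    using assms(2) by (auto simp: adj_def intro!: exI[of _ i])
  then have "[flip i origin, origin] \<in> saws N {origin} (flip i origin)"
    using assms(2) by (simp add: saws_def saw_def)
  then have "weight z [flip i origin, origin] \<le> to_origin N z (flip i origin)"
    unfolding gf_def by (rule member_le_sum) (auto simp: weight_nonneg assms)
  then show ?thesis by (simp add: weight_def)
qed

lemma two_point_nbr: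
  assumes "x \<in> hypercube N"
  shows "two_point N z x (flip i x) = to_origin N z (flip i origin)"
  using two_point_shift[OF assms, where z = z and x = "flip i origin" and y = origin]
  by (simp add: shift_flip two_point_sym)

text \<open>Immediate reversals contribute \<open>- N * z ^ 2 * to_origin N z x\<close> on the
  right; moving this to the left produces the denominator, which later compensates the excess of
  \<open>z * N\<close> over 1.\<close>

lemma to_origin_le_step:
  assumes z: "z \<ge> 0" and x: "x \<in> hypercube N"
    and g: "\<And>i. i < N \<Longrightarrow> to_origin N z (flip i origin) \<le> g"
  shows "to_origin N z x \<le> of_bool (x = origin) +
    z * (1 + z * g) / (1 + real N * z ^ 2) * nbr_sum N (to_origin N z) x"
proof -
  let ?f = "to_origin N z"
  have "?f x \<le> of_bool (x = origin) + z * (\<Sum>i<N. ?f (flip i x) - z * (?f x - ?f (flip i origin) * ?f (flip i x)))"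
    using gf_le_first_step[OF x z, where L = "{origin}"] by (simp add: two_point_nbr[OF x])
  also have "\<dots> \<le> of_bool (x = origin) + z * (\<Sum>i<N. (1 + z * g) * ?f (flip i x) - z * ?f x)"
  proof (intro add_left_mono mult_left_mono sum_mono z)
    fix i assume "i \<in> {..<N}"
    then have "z * (?f (flip i origin) * ?f (flip i x)) \<le> z * (g * ?f (flip i x))"
      using g z by (intro mult_left_mono mult_right_mono gf_nonneg) auto
    then show "?f (flip i x) - z * (?f x - ?f (flip i origin) * ?f (flip i x)) \<le> (1 + z * g) * ?f (flip i x) - z * ?f x"
      by (simp add: algebra_simps)
  qed
  also have "(\<Sum>i<N. (1 + z * g) * ?f (flip i x) - z * ?f x) = (1 + z * g) * nbr_sum N ?f x - real N * (z * ?f x)"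
    by (simp add: sum_subtractf nbr_sum_def sum_distrib_left)
  also have "of_bool (x = origin) + z * ((1 + z * g) * nbr_sum N ?f x - real N * (z * ?f x)) =
      of_bool (x = origin) + z * (1 + z * g) * nbr_sum N ?f x - real N * z ^ 2 * ?f x"
    by (simp add: power2_eq_square algebra_simps)
  finally have "?f x * (1 + real N * z ^ 2) \<le> of_bool (x = origin) + z * (1 + z * g) * nbr_sum N ?f x"
    by (simp add: algebra_simps)
  then have "?f x \<le> (of_bool (x = origin) + z * (1 + z * g) * nbr_sum N ?f x) / (1 + real N * z ^ 2)"
    by (subst pos_le_divide_eq) (auto simp: add_pos_nonneg)
  also have "\<dots> = of_bool (x = origin) / (1 + real N * z ^ 2) + z * (1 + z * g) / (1 + real N * z ^ 2) * nbr_sum N ?f x"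
    by (simp add: add_divide_distrib)
  also have "of_bool (x = origin) / (1 + real N * z ^ 2) \<le> (of_bool (x = origin) :: real)"
    by (simp add: divide_le_eq_1 add_pos_nonneg)
  finally show ?thesis by simp
qed

text \<open>Repeated substitution of the inequality into itself, legitimate since \<open>s\<close>
  and the kernel are nonnegative. The remainder is kept explicitly, for \<open>s * N\<close> may
  exceed 1.\<close>

lemma sub_solution_iterate:
  assumes s: "s \<ge> 0" and f: "\<And>x. x \<in> hypercube N \<Longrightarrow> f x \<le> of_bool (x = origin) + s * nbr_sum N f x"
    and x: "x \<in> hypercube N"
  shows "f x \<le> (\<Sum>n<T. s ^ n * walk_kernel N n x origin) +
    s ^ T * (\<Sum>y\<in>hypercube N. walk_kernel N T x y * f y)"
proof (induction T)
  case 0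
  show ?case using nbr_sum_iterate[OF x, of 0 f] by simp
next
  case (Suc T)
  have "(\<Sum>y\<in>hypercube N. walk_kernel N T x y * f y) \<le>
      (\<Sum>y\<in>hypercube N. walk_kernel N T x y * (of_bool (y = origin) + s * nbr_sum N f y))"
    by (intro sum_mono mult_left_mono f walk_kernel_nonneg x)
  also have "\<dots> = (\<Sum>y\<in>hypercube N. walk_kernel N T x y * of_bool (y = origin)) +
      s * (\<Sum>y\<in>hypercube N. walk_kernel N T x y * nbr_sum N f y)"
    by (simp add: algebra_simps sum.distrib sum_distrib_left)
  also have "(\<Sum>y\<in>hypercube N. walk_kernel N T x y * of_bool (y = origin)) = walk_kernel N T x origin"
  proof -
    have "(\<Sum>y\<in>hypercube N. walk_kernel N T x y * of_bool (y = origin)) =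
        (\<Sum>y\<in>hypercube N. if y = origin then walk_kernel N T x y else 0)"
      by (intro sum.cong) auto
    then show ?thesis by (simp add: finite_hypercube)
  qed
  also have "(\<Sum>y\<in>hypercube N. walk_kernel N T x y * nbr_sum N f y) =
      (\<Sum>y\<in>hypercube N. walk_kernel N (Suc T) x y * f y)"
    using nbr_sum_iterate[OF x, of T "nbr_sum N f"] nbr_sum_iterate[OF x, of "Suc T" f]
    by (simp add: funpow_swap1)
  finally have "s ^ T * (\<Sum>y\<in>hypercube N. walk_kernel N T x y * f y) \<le>
      s ^ T * (walk_kernel N T x origin + s * (\<Sum>y\<in>hypercube N. walk_kernel N (Suc T) x y * f y))"
    using s by (intro mult_left_mono) auto
  then show ?case using Suc by (simp add: algebra_simps)
qed

lemma sum_to_origin: "(\<Sum>y\<in>hypercube N. to_origin N z y) = susceptibility N z"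
  by (simp add: susceptibility_eq_gf gf_UNIV_eq_sum_two_point two_point_sym[of N z _ origin])

section \<open>Iterating until the walk has mixed\<close>

text \<open>The assumptions on \<open>T\<close> pull in opposite directions: \<open>mixing\<close>
  asks for enough steps to equidistribute the walk, \<open>growth\<close> for few enough that
  \<open>s * N\<close> slightly above 1 does no harm.\<close>

locale comparison =
  fixes N T :: nat and z s :: real
  assumes N: "N \<ge> 1" and T: "T \<ge> 3" and z: "z \<ge> 0" and s: "s \<ge> 0"
    and mixing: "real N * exp (- 2 * real T / real N) \<le> 1"
    and growth: "\<And>n. n \<le> T \<Longrightarrow> (s * real N) ^ n \<le> 2"
    and step: "\<And>x. x \<in> hypercube N \<Longrightarrow>
      to_origin N z x \<le> of_bool (x = origin) + s * nbr_sum N (to_origin N z) x"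
begin

text \<open>After \<open>T\<close> steps the walk has forgotten its start: in the remainder each
  \<open>y\<close> gets weight at most \<open>2 * (6 / 2 ^ N)\<close>, and the two-point function
  sums to the susceptibility.\<close>

lemma to_origin_le:
  assumes x: "x \<in> hypercube N"
  shows "to_origin N z x \<le> (\<Sum>n<T. s ^ n * walk_kernel N n x origin) + 12 * susceptibility N z / 2 ^ N"
proof -
  have "s ^ T * (\<Sum>y\<in>hypercube N. walk_kernel N T x y * to_origin N z y) =
      (\<Sum>y\<in>hypercube N. s ^ T * walk_kernel N T x y * to_origin N z y)"
    by (simp add: sum_distrib_left mult.assoc)
  also have "\<dots> \<le> (\<Sum>y\<in>hypercube N. 12 / 2 ^ N * to_origin N z y)"
  proof (intro sum_mono mult_right_mono gf_nonneg z)
    fix y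
    have "s ^ T * walk_kernel N T x y \<le> s ^ T * (real N ^ T * mean N (\<lambda>c. \<bar>eigval N c\<bar> ^ T))"
      using walk_kernel_le[OF N, of T x y] s by (intro mult_left_mono) auto
    also have "\<dots> = (s * real N) ^ T * mean N (\<lambda>c. \<bar>eigval N c\<bar> ^ T)"
      by (simp add: power_mult_distrib)
    also have "\<dots> \<le> 2 * (6 / 2 ^ N)"
      by (intro mult_mono growth mean_eigval_power_le N mixing) (auto simp: mean_def sum_nonneg)
    finally show "s ^ T * walk_kernel N T x y \<le> 12 / 2 ^ N" by simp
  qed
  also have "\<dots> = 12 * susceptibility N z / 2 ^ N"
    unfolding sum_distrib_left[symmetric] sum_to_origin by simp
  finally show ?thesis
    using sub_solution_iterate[OF s step x, of T] by linarith
qed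

text \<open>Replaces \<open>s\<close> by \<open>1 / N\<close> at the cost of a factor 2. The indices
  \<open>n\<close> and \<open>k\<close> are separate because \<open>nbr_mass_le\<close> uses
  \<open>k = Suc n\<close>.\<close>

lemma power_walk_kernel_le:
  assumes "x \<in> hypercube N" "y \<in> hypercube N" "n \<le> T"
  shows "s ^ n * walk_kernel N k x y \<le> 2 * (walk_kernel N k x y / real N ^ n)"
proof -
  have "s ^ n * walk_kernel N k x y = (s * real N) ^ n * (walk_kernel N k x y / real N ^ n)"
    using N by (simp add: power_mult_distrib)
  also have "\<dots> \<le> 2 * (walk_kernel N k x y / real N ^ n)"
    using assms by (intro mult_right_mono growth divide_nonneg_nonneg walk_kernel_nonneg) auto
  finally show ?thesis .
qed

text \<open>Squaring \<open>to_origin_le\<close> separates the truncated Green function, handled by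
  \<open>sum_green_sq\<close>, from the constant remainder, whose square is summed over at most
  \<open>2 ^ N\<close> points.\<close>

lemma bubble_le:
  "bubble N z \<le> 8 * (8 / real N + (real T ^ 2 + 2) * tail N) + 288 * (susceptibility N z)\<^sup>2 / 2 ^ N"
proof -
  let ?a = "\<lambda>x. \<Sum>n<T. walk_kernel N n x origin / real N ^ n"
  let ?c = "6 * susceptibility N z / 2 ^ N"
  have a_nonneg: "?a x \<ge> 0" if "x \<in> hypercube N" for x
    using that by (intro sum_nonneg divide_nonneg_nonneg walk_kernel_nonneg) auto
  have sq: "(2 * (a + c))\<^sup>2 \<le> 8 * a\<^sup>2 + 8 * c\<^sup>2" for a c :: real
    using zero_le_power2[of "a - c"] by (simp add: power2_eq_square algebra_simps)
  have c_nonneg: "?c \<ge> 0" using susceptibility_ge_1[OF z, of N] by simp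
  have "bubble N z = (\<Sum>x\<in>hypercube N - {origin}. (to_origin N z x)\<^sup>2)"
    by (simp add: bubble_def two_point_sym[of N z origin])
  also have "\<dots> \<le> (\<Sum>x\<in>hypercube N - {origin}. 8 * (?a x)\<^sup>2 + 8 * ?c\<^sup>2)"
  proof (rule sum_mono)
    fix x assume "x \<in> hypercube N - {origin}"
    then have x: "x \<in> hypercube N" by simp
    have "(\<Sum>n<T. s ^ n * walk_kernel N n x origin) \<le> 2 * ?a x"
      unfolding sum_distrib_left using x by (intro sum_mono power_walk_kernel_le) auto
    then have "to_origin N z x \<le> 2 * (?a x + ?c)"
      using to_origin_le[OF x] by simp
    then have "(to_origin N z x)\<^sup>2 \<le> (2 * (?a x + ?c))\<^sup>2"
      by (intro power_mono gf_nonneg z)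
    also have "\<dots> \<le> 8 * (?a x)\<^sup>2 + 8 * ?c\<^sup>2"
      by (rule sq)
    finally show "(to_origin N z x)\<^sup>2 \<le> 8 * (?a x)\<^sup>2 + 8 * ?c\<^sup>2" .
  qed
  also have "\<dots> = 8 * (\<Sum>x\<in>hypercube N - {origin}. (?a x)\<^sup>2) + (2 ^ N - 1) * (8 * ?c\<^sup>2)"
    by (simp add: sum.distrib card_hypercube of_nat_diff flip: sum_distrib_left)
  also have "\<dots> \<le> 8 * (8 / real N + (real T ^ 2 + 2) * tail N) + 2 ^ N * (8 * ?c\<^sup>2)"
  proof (intro add_mono mult_left_mono mult_right_mono)
    have "(\<Sum>x\<in>hypercube N. (?a x)\<^sup>2) = (?a origin)\<^sup>2 + (\<Sum>x\<in>hypercube N - {origin}. (?a x)\<^sup>2)"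
      by (rule sum.remove) (auto simp: finite_hypercube)
    \<comment> \<open>The origin contributes at least 1, which removes the leading 1 of
      \<open>mean_green_sq_le\<close>.\<close>
    moreover have "?a origin \<ge> walk_kernel N 0 origin origin / real N ^ 0"
      using T by (intro member_le_sum[where f = "\<lambda>n. walk_kernel N n origin origin / real N ^ n"]
        divide_nonneg_nonneg walk_kernel_nonneg) auto
    then have "?a origin \<ge> 1" by (simp add: walk_kernel_0)
    then have "(?a origin)\<^sup>2 \<ge> 1" by (simp add: one_le_power)
    ultimately show "(\<Sum>x\<in>hypercube N - {origin}. (?a x)\<^sup>2) \<le> 8 / real N + (real T ^ 2 + 2) * tail N"
      using sum_green_sq[OF N origin_in_hypercube, of T] mean_green_sq_le[OF N T] by linarith
  qed auto
  also have "2 ^ N * (8 * ?c\<^sup>2) = 288 * (susceptibility N z)\<^sup>2 / 2 ^ N"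
    by (simp add: power2_eq_square)
  finally show ?thesis .
qed

text \<open>Summing \<open>to_origin_le\<close> over the neighbours raises the kernel index by one,
  leaving closed walks at the origin, whose counts are moments: the first is 0, the second gives
  \<open>s * N\<close>, the others are bounded by \<open>sum_mean_eigval_le\<close>.\<close>

lemma nbr_mass_le:
  "nbr_mass N z \<le> s * real N + 12 / real N + 2 * real N * real T * tail N + 12 * real N * susceptibility N z / 2 ^ N"
proof -
  let ?c = "12 * susceptibility N z / 2 ^ N"
  have "nbr_mass N z \<le> nbr_sum N (\<lambda>x. (\<Sum>n<T. s ^ n * walk_kernel N n x origin) + ?c) origin"
    by (intro nbr_sum_mono to_origin_le) auto
  also have "\<dots> = (\<Sum>n<T. s ^ n * nbr_sum N (\<lambda>x. walk_kernel N n x origin) origin) + real N * ?c"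
    unfolding nbr_sum_def by (simp add: sum.distrib sum_distrib_left) (rule sum.swap)
  also have "(\<Sum>n<T. s ^ n * nbr_sum N (\<lambda>x. walk_kernel N n x origin) origin) =
      (\<Sum>n<T. s ^ n * walk_kernel N (Suc n) origin origin)"
    by (simp add: nbr_sum_walk_kernel)
  \<comment> \<open>The term \<open>n = 1\<close> keeps its factor \<open>s\<close> instead of the
    cruder \<open>2 / N\<close>, since the bootstrap compares \<open>s * N\<close> with
    \<open>z * N\<close>.\<close>
  also have "{..<T} = {0, 1} \<union> {2..<T}" using T by auto
  also have "(\<Sum>n\<in>{0, 1} \<union> {2..<T}. s ^ n * walk_kernel N (Suc n) origin origin) =
      walk_kernel N 1 origin origin + s * walk_kernel N 2 origin origin +
      (\<Sum>n\<in>{2..<T}. s ^ n * walk_kernel N (Suc n) origin origin)"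
    by (subst sum.union_disjoint) (auto simp: numeral_2_eq_2)
  also have "walk_kernel N 1 origin origin = 0"
    using mean_eigval(1)[OF N] by (simp add: walk_kernel_diag[OF N])
  also have "walk_kernel N 2 origin origin = real N"
    using mean_eigval(2)[OF N] N by (simp add: walk_kernel_diag[OF N] power2_eq_square)
  also have "(\<Sum>n\<in>{2..<T}. s ^ n * walk_kernel N (Suc n) origin origin) \<le>
      (\<Sum>n\<in>{2..<T}. 2 * real N * mean N (\<lambda>c. eigval N c ^ Suc n))"
  proof (rule sum_mono)
    fix n assume "n \<in> {2..<T}"
    then have "s ^ n * walk_kernel N (Suc n) origin origin \<le> 2 * (walk_kernel N (Suc n) origin origin / real N ^ n)"
      by (intro power_walk_kernel_le) auto
    also have "\<dots> = 2 * real N * mean N (\<lambda>c. eigval N c ^ Suc n)"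
      unfolding walk_kernel_diag[OF N] using N by simp
    finally show "s ^ n * walk_kernel N (Suc n) origin origin \<le> 2 * real N * mean N (\<lambda>c. eigval N c ^ Suc n)" .
  qed
  also have "\<dots> \<le> 2 * real N * (6 / real N ^ 2 + real T * tail N)"
    unfolding sum_distrib_left[symmetric]
    by (intro mult_left_mono sum_mean_eigval_le N T) auto
  finally show ?thesis using N by (simp add: power2_eq_square algebra_simps)
qed

end

section \<open>Large dimensions and the continuity argument\<close>

text \<open>
  The number of iterations is \<open>N\<^sup>2 / 200\<close>: below, \<open>s N \<le> 1 + 100 / N\<^sup>2\<close>, so the growth factor
  stays below \<open>exp (1 / 2)\<close>.
\<close>

definition large_dim :: "nat \<Rightarrow> bool" where
  "large_dim N \<longleftrightarrow> N \<ge> 30 \<and> real N * exp (- 2 * real (N ^ 2 div 200) / real N) \<le> 1 \<and>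
     72 / real N ^ 2 + 2 * real N * real N ^ 2 * tail N + 12 * real N / 2 powr (real N / 2) < 4 / real N \<and>
     (real N ^ 4 + 2) * tail N \<le> 1 / real N"

lemma eventually_large_dim: "eventually large_dim sequentially"
proof -
  \<comment> \<open>The \<open>2\<close> in the exponent absorbs the rounding in
    \<open>N ^ 2 div 200\<close>.\<close>
  have "eventually (\<lambda>N::nat. real N * exp (2 - real N / 100) \<le> 1) sequentially"
    by real_asymp
  then have 1: "eventually (\<lambda>N::nat. real N * exp (- 2 * real (N ^ 2 div 200) / real N) \<le> 1) sequentially"
  proof eventually_elim
    case (elim N)
    have "real (N ^ 2 div 200) \<ge> real N ^ 2 / 200 - 1"
    proof -
      have "m \<le> 200 * (m div 200) + 200" for m :: nat
        using div_mult_mod_eq[of m 200] mod_less_divisor[of 200 m] by linarith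
      from this[of "N ^ 2"] have "real (N ^ 2) \<le> real (200 * (N ^ 2 div 200) + 200)"
        by (rule of_nat_mono)
      then show ?thesis by simp
    qed
    then have "- 2 * real (N ^ 2 div 200) / real N \<le> - 2 * (real N ^ 2 / 200 - 1) / real N"
      by (intro divide_right_mono) auto
    also have "\<dots> \<le> 2 - real N / 100"
      by (cases "N = 0") (auto simp: field_simps power2_eq_square)
    finally have "real N * exp (- 2 * real (N ^ 2 div 200) / real N) \<le> real N * exp (2 - real N / 100)"
      by (intro mult_left_mono) auto
    then show ?case using elim by linarith
  qed
  have 2: "eventually (\<lambda>N::nat. 72 / real N ^ 2 + 2 * real N * real N ^ 2 * tail N + 12 * real N / 2 powr (real N / 2) < 4 / real N) sequentially"
    unfolding tail_def by real_asymp
  have 3: "eventually (\<lambda>N::nat. (real N ^ 4 + 2) * tail N \<le> 1 / real N) sequentially"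
    unfolding tail_def by real_asymp
  show ?thesis
    using 1 2 3 eventually_ge_at_top[of 30] unfolding large_dim_def by eventually_elim auto
qed

lemma tail_nonneg: "tail N \<ge> 0"
  by (simp add: tail_def)

text \<open>Each neighbour's value is at least \<open>z\<close>, so the excess \<open>16 / N\<close>
  of the sum bounds each single excess, and \<open>z * g\<close> is of order
  \<open>1 / N ^ 2\<close>. Then \<open>fugacity_less\<close> gives
  \<open>z * N < 1 + N * z ^ 2 + 32 / N ^ 2\<close>, and the denominator of \<open>s\<close> cancels
  the factor \<open>1 + N * z ^ 2\<close>.\<close>

lemma comparison_intro:
  assumes L: "large_dim N" and z: "z \<ge> 0"
    and zN: "z * real N \<le> 2" and h: "nbr_mass N z \<le> z * real N + 16 / real N"
  defines "s \<equiv> z * (1 + z * (z + 16 / real N)) / (1 + real N * z ^ 2)"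
  shows "comparison N (N ^ 2 div 200) z s" and "s * real N \<le> z * real N + 72 / real N ^ 2"
    and "z * real N < 2"
proof -
  have N: "N \<ge> 30" and mix: "real N * exp (- 2 * real (N ^ 2 div 200) / real N) \<le> 1"
    using L by (auto simp: large_dim_def)
  have N0: "real N > 0" using N by simp
  have N2: "900 \<le> N ^ 2" using power_mono[OF N, of 2] by simp
  define g where "g = z + 16 / real N"
  have z2: "z \<le> 2 / real N" using zN N0 by (simp add: field_simps)
  have g18: "g \<le> 18 / real N" unfolding g_def using z2 by (simp add: add_divide_distrib[symmetric] field_simps)
  have g0: "g \<ge> 0" unfolding g_def using z by simp
  have g: "to_origin N z (flip i origin) \<le> g" if "i < N" for i
  proof -
    have "to_origin N z (flip i origin) - z \<le> (\<Sum>i<N. to_origin N z (flip i origin) - z)"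
      using that z by (intro member_le_sum[where f = "\<lambda>i. to_origin N z (flip i origin) - z"])
        (auto simp: to_origin_ge)
    also have "\<dots> = nbr_mass N z - z * real N" by (simp add: sum_subtractf nbr_sum_def)
    finally show ?thesis using h by (simp add: g_def)
  qed
  have zg: "z * g \<le> 36 / real N ^ 2"
    using mult_mono[OF z2 g18] z g0 N0 by (simp add: power2_eq_square)
  have "z * nbr_mass N z \<le> z * (z * real N + 16 / real N)"
    using h z by (intro mult_left_mono)
  also have "\<dots> = real N * z ^ 2 + z * (16 / real N)"
    by (simp add: power2_eq_square algebra_simps)
  also have "z * (16 / real N) \<le> 2 / real N * (16 / real N)"
    using z2 by (intro mult_right_mono) auto
  also have "\<dots> = 32 / real N ^ 2" by (simp add: power2_eq_square)
  finally have "z * nbr_mass N z \<le> real N * z ^ 2 + 32 / real N ^ 2" by simp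
  then have zN': "z * real N < 1 + real N * z ^ 2 + 32 / real N ^ 2"
    using fugacity_less[OF z, of N] by linarith
  have "real N * z ^ 2 \<le> real N * (2 / real N) ^ 2"
    using z2 z by (intro mult_left_mono power_mono) auto
  also have "\<dots> = 4 / real N" using N0 by (simp add: power2_eq_square)
  also have "\<dots> \<le> 4 / 30" using N by (intro divide_left_mono) auto
  finally have "real N * z ^ 2 \<le> 4 / 30" .
  moreover have "32 / real N ^ 2 \<le> 32 / 900"
    using N2 N by (intro divide_left_mono) (auto simp flip: of_nat_power)
  ultimately show "z * real N < 2" using zN' by simp
  have s_eq: "s * real N = (z * real N) * (1 + z * g) / (1 + real N * z ^ 2)"
    by (simp add: s_def g_def)
  have den: "1 + real N * z ^ 2 \<ge> 1" by simp
  have s0: "s \<ge> 0" unfolding s_def using z by simp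
  have "s * real N \<le> (z * real N) * (1 + z * g) / 1"
    unfolding s_eq using den z g0 by (intro divide_left_mono) (auto simp: add_pos_nonneg)
  also have "\<dots> = z * real N + (z * real N) * (z * g)" by (simp add: algebra_simps)
  also have "(z * real N) * (z * g) \<le> 2 * (36 / real N ^ 2)"
    using zN zg z g0 by (intro mult_mono) auto
  finally show "s * real N \<le> z * real N + 72 / real N ^ 2" by simp
  have "s * real N \<le> ((1 + real N * z ^ 2) * (1 + 32 / real N ^ 2)) * (1 + 36 / real N ^ 2) / (1 + real N * z ^ 2)"
    unfolding s_eq
  proof (rule divide_right_mono, rule mult_mono)
    have "32 / real N ^ 2 \<le> (1 + real N * z ^ 2) * (32 / real N ^ 2)"
      using mult_right_mono[OF den, of "32 / real N ^ 2"] by simp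
    then show "z * real N \<le> (1 + real N * z ^ 2) * (1 + 32 / real N ^ 2)"
      using zN' by (simp only: distrib_left mult_1_right)
  qed (use zg z g0 in auto)
  also have "\<dots> = (1 + 32 / real N ^ 2) * (1 + 36 / real N ^ 2)"
  proof -
    have "1 + real N * z ^ 2 \<noteq> 0" using den by linarith
    then show ?thesis unfolding mult.assoc by (rule nonzero_mult_div_cancel_left)
  qed
  also have "\<dots> = 1 + 68 / real N ^ 2 + (32 / real N ^ 2) * (36 / real N ^ 2)"
    by (simp add: algebra_simps add_divide_distrib[symmetric])
  \<comment> \<open>The product is absorbed as a further \<open>32 / N ^ 2\<close>, and
    \<open>68 + 32\<close> is the \<open>100\<close> that fixes the number of iterations.\<close>
  also have "(32 / real N ^ 2) * (36 / real N ^ 2) \<le> (32 / real N ^ 2) * 1"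
    using N2 by (intro mult_left_mono) (auto simp: divide_le_eq_1 simp flip: of_nat_power)
  finally have sN: "s * real N \<le> 1 + 100 / real N ^ 2" by (simp add: add_divide_distrib[symmetric])
  have growth: "(s * real N) ^ n \<le> 2" if "n \<le> N ^ 2 div 200" for n
  proof -
    have "(s * real N) ^ n \<le> exp (100 / real N ^ 2) ^ n"
    proof (rule power_mono)
      show "s * real N \<le> exp (100 / real N ^ 2)"
        using sN exp_ge_add_one_self[of "100 / real N ^ 2"] by linarith
    qed (use s0 in simp)
    also have "\<dots> = exp (real n * (100 / real N ^ 2))" by (rule exp_of_nat_mult[symmetric])
    also have "real n * (100 / real N ^ 2) \<le> (real N ^ 2 / 200) * (100 / real N ^ 2)"
    proof (rule mult_right_mono)
      have "real n \<le> real (N ^ 2 div 200)" using that by simp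
      also have "\<dots> \<le> real (N ^ 2) / 200" using of_nat_div_le_of_nat[of "N ^ 2" 200] by simp
      finally show "real n \<le> real N ^ 2 / 200" by simp
    qed simp
    also have "\<dots> = 1 / 2" using N0 by simp
    also have "exp (1 / 2) \<le> (2 :: real)"
    proof -
      have "exp (1 / 2) ^ 2 \<le> (2 :: real) ^ 2"
        using exp_le by (simp flip: exp_of_nat_mult)
      then show ?thesis by (rule power2_le_imp_le) simp
    qed
    finally show ?thesis by simp
  qed
  show "comparison N (N ^ 2 div 200) z s"
  proof
    show "3 \<le> N ^ 2 div 200" using N2 by simp
    show "to_origin N z x \<le> of_bool (x = origin) + s * nbr_sum N (to_origin N z) x"
      if "x \<in> hypercube N" for x
      using to_origin_le_step[OF z that g] by (simp add: s_def g_def)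
  qed (use N z s0 mix growth in auto)
qed

text \<open>
  The hypothesis on \<open>nbr_mass\<close> returns with strict inequality, so by continuity in \<open>z\<close> it is never
  violated. The value \<open>16\<close> only has to exceed the \<open>12\<close> of \<open>nbr_mass_le\<close>.
\<close>

lemma nbr_mass_bootstrap:
  assumes L: "large_dim N" and z: "z \<ge> 0"
    and zN: "z * real N \<le> 2" and h: "nbr_mass N z \<le> z * real N + 16 / real N"
    and chi: "susceptibility N z \<le> 2 powr (real N / 2)"
  shows "nbr_mass N z < z * real N + 16 / real N"
proof -
  let ?T = "N ^ 2 div 200"
  define s where "s = z * (1 + z * (z + 16 / real N)) / (1 + real N * z ^ 2)"
  interpret comparison N ?T z s
    using comparison_intro(1)[OF L z zN h] by (simp add: s_def)
  have "real ?T \<le> real N ^ 2"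
    by (metis div_le_dividend of_nat_le_iff of_nat_power)
  then have "2 * real N * real ?T * tail N \<le> 2 * real N * real N ^ 2 * tail N"
    by (intro mult_right_mono mult_left_mono tail_nonneg) auto
  moreover have "12 * real N * susceptibility N z / 2 ^ N \<le> 12 * real N / 2 powr (real N / 2)"
  proof -
    have "2 ^ N = 2 powr (real N / 2) * (2 powr (real N / 2) :: real)"
      by (simp add: powr_realpow flip: powr_add)
    then have "susceptibility N z / 2 ^ N \<le> 1 / 2 powr (real N / 2)"
      using chi by (simp add: field_simps)
    then have "12 * real N * (susceptibility N z / 2 ^ N) \<le> 12 * real N * (1 / 2 powr (real N / 2))"
      by (intro mult_left_mono) auto
    then show ?thesis by simp
  qed
  moreover have "s * real N \<le> z * real N + 72 / real N ^ 2"
    using comparison_intro(2)[OF L z zN h] by (simp add: s_def)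
  moreover have "72 / real N ^ 2 + 2 * real N * real N ^ 2 * tail N + 12 * real N / 2 powr (real N / 2) < 4 / real N"
    using L by (simp add: large_dim_def)
  moreover have "12 / real N + 4 / real N = 16 / real N"
    by (simp add: add_divide_distrib[symmetric])
  ultimately show ?thesis using nbr_mass_le by linarith
qed

lemma nbr_mass_0: "nbr_mass N 0 = 0"
proof -
  have "to_origin N 0 (flip i origin) = 0" if "i < N" for i
    using gf_first_step[where x = "flip i origin" and N = N and z = 0 and L = "{origin}"] that by simp
  then show ?thesis by (simp add: nbr_sum_def)
qed

lemma continuous_on_nbr_mass: "continuous_on A (nbr_mass N)"
  unfolding nbr_sum_def gf_def weight_def by (intro continuous_intros)

lemma nbr_mass_bound:
  assumes L: "large_dim N" and z: "0 \<le> z" and chi: "susceptibility N z \<le> 2 powr (real N / 2)"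
  shows "z * real N \<le> 2" "nbr_mass N z \<le> z * real N + 16 / real N"
proof -
  \<comment> \<open>Both bounds, rescaled to \<open>\<le> 1\<close>, are merged so that one
    application of the intermediate value theorem covers them. Where \<open>?F\<close> equals 1 both
    bounds hold, hence hold strictly, a contradiction.\<close>
  let ?F = "\<lambda>w. max (w * real N / 2) ((nbr_mass N w - w * real N) * real N / 16)"
  have N0: "real N > 0" using L by (simp add: large_dim_def)
  have "?F z \<le> 1"
  proof (rule ccontr)
    assume "\<not> ?F z \<le> 1"
    then have "1 \<le> ?F z" by (rule nle_le[THEN iffD1, THEN conjunct1])
    moreover have "?F 0 \<le> 1" by (simp add: nbr_mass_0)
    moreover have "continuous_on {0..z} ?F"
      by (intro continuous_intros continuous_on_nbr_mass) auto
    ultimately have "\<exists>w\<ge>0. w \<le> z \<and> ?F w = 1"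
      using z by (intro IVT'[of ?F 0 1 z])
    then obtain w where w: "0 \<le> w" "w \<le> z" "?F w = 1" by blast
    then have "w * real N / 2 \<le> 1" "(nbr_mass N w - w * real N) * real N / 16 \<le> 1"
      by (metis max.cobounded1, metis max.cobounded2)
    then have 1: "w * real N \<le> 2" "nbr_mass N w \<le> w * real N + 16 / real N"
      using N0 by (auto simp: field_simps)
    moreover have "susceptibility N w \<le> 2 powr (real N / 2)"
      using susceptibility_mono[OF w(1,2), of N] chi by simp
    ultimately have "w * real N < 2" "nbr_mass N w < w * real N + 16 / real N"
      using comparison_intro(3)[OF L w(1)] nbr_mass_bootstrap[OF L w(1)] by auto
    then have "w * real N / 2 < 1" "(nbr_mass N w - w * real N) * real N / 16 < 1"
      using N0 by (auto simp: field_simps)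
    then show False using w(3) by linarith
  qed
  then have "z * real N / 2 \<le> 1" "(nbr_mass N z - z * real N) * real N / 16 \<le> 1"
    by auto
  then show "z * real N \<le> 2" "nbr_mass N z \<le> z * real N + 16 / real N"
    using N0 by (auto simp: field_simps)
qed

lemma bubble_bound:
  assumes L: "large_dim N" and z: "0 \<le> z" and chi: "susceptibility N z \<le> 2 powr (real N / 2)"
  shows "bubble N z \<le> 72 / real N + 288 * (susceptibility N z)\<^sup>2 / 2 ^ N"
proof -
  let ?T = "N ^ 2 div 200"
  interpret comparison N ?T z "z * (1 + z * (z + 16 / real N)) / (1 + real N * z ^ 2)"
    using comparison_intro(1)[OF L z nbr_mass_bound[OF assms]] .
  have "real ?T \<le> real N ^ 2"
    by (metis div_le_dividend of_nat_le_iff of_nat_power)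
  then have "real ?T ^ 2 \<le> (real N ^ 2) ^ 2" by (intro power_mono) auto
  then have "(real ?T ^ 2 + 2) * tail N \<le> (real N ^ 4 + 2) * tail N"
    by (intro mult_right_mono tail_nonneg) (simp flip: power_mult)
  also have "\<dots> \<le> 1 / real N" using L by (simp add: large_dim_def)
  \<comment> \<open>\<open>72\<close> is \<open>8 * (8 + 1)\<close>.\<close>
  finally show ?thesis using bubble_le by (simp add: add_divide_distrib[symmetric])
qed

section \<open>The differential inequalities\<close>

text \<open>\<open>gf_len\<close> is the derivative of \<open>w * chi\<close>, with
  \<open>chi\<close> the susceptibility, and \<open>k / w ^ 2\<close> equals
  \<open>k * chi ^ 2 / (w * chi) ^ 2\<close>; so the sign is decided by comparing
  \<open>gf_len\<close> with \<open>k * chi ^ 2\<close>.\<close>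

lemma inverse_mass_derivative:
  assumes "w > 0"
  shows "((\<lambda>w. 1 / (w * susceptibility N w) - k / w) has_real_derivative
    (k * (susceptibility N w)\<^sup>2 - gf_len N w origin) / (w * susceptibility N w)\<^sup>2) (at w)"
proof -
  let ?chi = "susceptibility N w"
  have chi: "?chi > 0" using susceptibility_ge_1[of w N] assms by simp
  have "((\<lambda>w. inverse (w * susceptibility N w) - k * inverse w) has_real_derivative
      - (inverse (w * ?chi) * gf_len N w origin * inverse (w * ?chi)) - k * (- (inverse w * 1 * inverse w))) (at w)"
    using assms chi
    by (intro DERIV_diff DERIV_inverse' DERIV_cmult has_derivative_susceptibility DERIV_ident) auto
  moreover have "- (inverse (w * ?chi) * gf_len N w origin * inverse (w * ?chi)) - k * (- (inverse w * 1 * inverse w)) =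
      (k * ?chi\<^sup>2 - gf_len N w origin) / (w * ?chi)\<^sup>2"
    using assms chi by (simp add: field_simps power2_eq_square)
  ultimately show ?thesis by (simp add: field_simps)
qed

text \<open>By \<open>gf_len_bounds(1)\<close> the function \<open>?phi\<close> is nondecreasing;
  the claim is \<open>?phi z \<le> ?phi w\<close> multiplied by \<open>z\<close>.\<close>

lemma inverse_susceptibility_le:
  assumes z: "0 < z" "z \<le> w"
  shows "1 / susceptibility N z \<le> (z / w) / susceptibility N w + 1 - z / w"
proof -
  let ?phi = "\<lambda>u. 1 / (u * susceptibility N u) - 1 / u"
  have "?phi z \<le> ?phi w"
  proof (rule DERIV_nonneg_imp_nondecreasing[OF z(2)])
    fix u assume "z \<le> u" "u \<le> w"
    then have "u > 0" using z by simp
    moreover have "(1 * (susceptibility N u)\<^sup>2 - gf_len N u origin) / (u * susceptibility N u)\<^sup>2 \<ge> 0"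
      using gf_len_bounds(1)[of u N] \<open>u > 0\<close> by simp
    ultimately show "\<exists>y. (?phi has_real_derivative y) (at u) \<and> y \<ge> 0"
      using inverse_mass_derivative[of u N 1] by blast
  qed
  then have "z * ?phi z \<le> z * ?phi w" using z by (intro mult_left_mono) auto
  then show ?thesis using z by (simp add: right_diff_distrib)
qed

text \<open>The mirror image, with \<open>?phi\<close> nonincreasing. In the application
  \<open>k\<close> is one minus a uniform bound on the bubble.\<close>

lemma inverse_susceptibility_ge:
  assumes z: "0 < z" "z \<le> w"
    and k: "\<And>u. z \<le> u \<Longrightarrow> u \<le> w \<Longrightarrow> k * (susceptibility N u)\<^sup>2 \<le> gf_len N u origin"
  shows "1 / susceptibility N z \<ge> (z / w) / susceptibility N w + k * (1 - z / w)"
proof -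
  let ?phi = "\<lambda>u. 1 / (u * susceptibility N u) - k / u"
  have "?phi z \<ge> ?phi w"
  proof (rule DERIV_nonpos_imp_nonincreasing[OF z(2)])
    fix u assume u: "z \<le> u" "u \<le> w"
    then have "u > 0" using z by simp
    moreover have "(k * (susceptibility N u)\<^sup>2 - gf_len N u origin) / (u * susceptibility N u)\<^sup>2 \<le> 0"
      using k[OF u] by (intro divide_nonpos_nonneg) auto
    ultimately show "\<exists>y. (?phi has_real_derivative y) (at u) \<and> y \<le> 0"
      using inverse_mass_derivative[of u N k] by blast
  qed
  then have "z * ?phi z \<ge> z * ?phi w" using z by (intro mult_left_mono) auto
  then show ?thesis using z by (simp add: right_diff_distrib mult.commute)
qed

section \<open>From the integrated inequalities to the theorem\<close>

text \<open>Integration yields \<open>t * a\<close> where the final denominator has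
  \<open>a\<close>; the numerator \<open>2 - t\<close>, together with the enlargement of
  \<open>d\<close> to \<open>2 * d\<close>, pays for the difference.\<close>

lemma upper_bound_from_inverse:
  fixes a d t X :: real
  assumes a: "0 < a" "a \<le> 1" and d: "0 \<le> d" "2 * d < 1" and t: "0 \<le> t" "t \<le> 1" and X: "X > 0"
    and inv: "1 / X \<ge> t * a + (1 - d) * (1 - t)"
  shows "X \<le> (2 - t) / (a + (1 - 2 * d) * (1 - t))"
proof -
  have den: "a + (1 - 2 * d) * (1 - t) > 0"
    using a d t by (intro add_pos_nonneg mult_nonneg_nonneg) auto
  \<comment> \<open>This is exactly the difference of the two sides of the next inequality.\<close>
  have "(1 - t)\<^sup>2 * (1 - a) + d * ((1 - t) * t) \<ge> 0"
    using a d t by (intro add_nonneg_nonneg mult_nonneg_nonneg) auto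
  then have "a + (1 - 2 * d) * (1 - t) \<le> (2 - t) * (t * a + (1 - d) * (1 - t))"
    by (simp add: power2_eq_square algebra_simps)
  also have "\<dots> \<le> (2 - t) * (1 / X)" using inv t by (intro mult_left_mono) auto
  finally have "X * (a + (1 - 2 * d) * (1 - t)) \<le> 2 - t" using X by (simp add: field_simps)
  then show ?thesis using den by (simp add: pos_le_divide_eq)
qed

theorem theorem1p4:
  shows "\<exists>lam0>0. \<exists>C::real. \<forall>lam. 0 < lam \<and> lam \<le> lam0 \<longrightarrow>
    (\<forall>N\<ge>1. lam * real (vol N) powr (1 / 2) > 1 \<longrightarrow>
      (let zN = critical_value N lam; \<beta> = inverse (real N) + lam ^ 2 in
       \<forall>z\<in>{0..zN}.
         1 / (inverse lam * real (vol N) powr (- 1 / 2) + 1 - z / zN) \<le> susceptibility N z \<and>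
         (\<exists>\<epsilon>. \<bar>\<epsilon>\<bar> \<le> C * \<beta> \<and>
            susceptibility N z \<le>
              (2 - z / zN) /
              (inverse lam * real (vol N) powr (- 1 / 2) + (1 - \<epsilon>) * (1 - z / zN)))))"
proof -
  obtain N0 where N0: "\<And>N. N \<ge> N0 \<Longrightarrow> large_dim N"
    using eventually_large_dim by (auto simp: eventually_sequentially)
  \<comment> \<open>\<open>N0\<close> makes the error term at least 1 in dimensions up to
    \<open>N0\<close>; \<open>600\<close> is the constant 300 of the bubble bound, doubled by
    \<open>upper_bound_from_inverse\<close>.\<close>
  define C where "C = max (real N0) 600"
  show ?thesis
  \<comment> \<open>The choice 1 for the bound on \<open>lam\<close> keeps the susceptibility below
    \<open>2 powr (N / 2)\<close> up to the critical value, as \<open>bubble_bound\<close>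
    requires.\<close>
  proof (rule exI[of _ 1], intro conjI exI[of _ C] allI impI, simp, unfold Let_def, intro ballI)
    fix lam :: real and N :: nat and z :: real
    define zN where "zN = critical_value N lam"
    define \<beta> where "\<beta> = inverse (real N) + lam ^ 2"
    define a where "a = inverse lam * real (vol N) powr (- 1 / 2)"
    define t where "t = z / zN"
    assume lam: "0 < lam \<and> lam \<le> 1" and N: "1 \<le> N" and V: "1 < lam * real (vol N) powr (1 / 2)"
      and "z \<in> {0..critical_value N lam}"
    then have z: "0 \<le> z" "z \<le> zN" by (auto simp: zN_def)
    have crit: "zN > 0" "susceptibility N zN = lam * real (vol N) powr (1 / 2)"
      using theI'[OF critical_value_ex1[OF N V]] by (simp_all add: zN_def critical_value_def)
    have chi_pos: "susceptibility N w > 0" if "w \<ge> 0" for w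
      using susceptibility_ge_1[OF that, of N] by simp
    have a: "a = 1 / susceptibility N zN"
      unfolding a_def crit(2) by (simp add: powr_minus field_simps)
    have a01: "0 < a" "a \<le> 1"
      unfolding a using susceptibility_ge_1[of zN N] crit(1) by auto
    have t: "0 \<le> t" "t \<le> 1" using z crit(1) by (auto simp: t_def)
    have lower: "1 / (a + 1 - t) \<le> susceptibility N z"
    proof -
      have "1 / susceptibility N z \<le> a + 1 - t"
      \<comment> \<open>The integration involves \<open>1 / z\<close>, so \<open>z = 0\<close> is
        separate; there the susceptibility is 1.\<close>
      proof (cases "z = 0")
        case True
        then show ?thesis using a01 by (simp add: t_def susceptibility_0)
      next
        case False
        then have "1 / susceptibility N z \<le> t * a + 1 - t"
          using inverse_susceptibility_le[of z zN N] z by (simp add: t_def a)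
        also have "t * a \<le> a" using t a01 by (simp add: mult_left_le_one_le)
        finally show ?thesis by simp
      qed
      then show ?thesis using chi_pos[OF z(1)] t a01 by (simp add: field_simps)
    qed
    have upper: "\<exists>\<epsilon>. \<bar>\<epsilon>\<bar> \<le> C * \<beta> \<and> susceptibility N z \<le> (2 - t) / (a + (1 - \<epsilon>) * (1 - t))"
    proof (cases "C * \<beta> \<ge> 1")
      case True
      \<comment> \<open>An error term of 1 removes \<open>1 - t\<close> from the denominator, and
        monotonicity up to the critical value \<open>1 / a\<close> suffices.\<close>
      have "susceptibility N z \<le> 1 / a"
        using susceptibility_mono[OF z] by (simp add: a)
      also have "\<dots> \<le> (2 - t) / a" using t a01 by (intro divide_right_mono) auto
      finally show ?thesis using True by (intro exI[of _ 1]) simp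
    next
      case False
      have \<beta>: "\<beta> > 0" using N by (simp add: \<beta>_def add_pos_nonneg)
      have "real N > real N0"
      proof (rule ccontr)
        assume "\<not> real N > real N0"
        then have "C \<ge> real N" by (simp add: C_def)
        then have "C * inverse (real N) \<ge> real N * inverse (real N)" by (intro mult_right_mono) auto
        moreover have "C * lam ^ 2 \<ge> 0" by (simp add: C_def)
        ultimately show False using False N by (simp add: \<beta>_def distrib_left)
      qed
      then have L: "large_dim N" by (intro N0) simp
      have C600: "600 * \<beta> \<le> C * \<beta>" using \<beta> by (intro mult_right_mono) (auto simp: C_def)
      have vol: "real (vol N) = 2 powr real N" "real (vol N) = 2 ^ N"
        by (simp_all add: vol_def powr_realpow)
      have d: "bubble N u \<le> 300 * \<beta>" if u: "0 \<le> u" "u \<le> zN" for u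
      proof -
        have chi: "susceptibility N u \<le> lam * 2 powr (real N / 2)"
          using susceptibility_mono[OF u, of N] crit(2) unfolding vol(1) by (simp add: powr_powr)
        also have "\<dots> \<le> 1 * 2 powr (real N / 2)" using lam by (intro mult_right_mono) auto
        finally have "bubble N u \<le> 72 / real N + 288 * (susceptibility N u)\<^sup>2 / 2 ^ N"
          using bubble_bound[OF L u(1)] by simp
        also have "(susceptibility N u)\<^sup>2 \<le> (lam * 2 powr (real N / 2))\<^sup>2"
          using chi chi_pos[OF u(1)] by (intro power_mono) auto
        also have "\<dots> = lam ^ 2 * 2 ^ N"
          by (simp add: power_mult_distrib power2_eq_square[of "2 powr _"] powr_realpow flip: powr_add)
        finally have "bubble N u \<le> 72 / real N + 288 * lam ^ 2"
          by (simp add: divide_right_mono)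
        \<comment> \<open>\<open>300\<close> exceeds both 72 and 288.\<close>
        also have "\<dots> \<le> 300 * \<beta>" using N by (simp add: \<beta>_def divide_inverse)
        finally show ?thesis .
      qed
      have "susceptibility N z \<le> (2 - t) / (a + (1 - 2 * (300 * \<beta>)) * (1 - t))"
      proof (rule upper_bound_from_inverse[OF a01 _ _ t chi_pos[OF z(1)]])
        show "2 * (300 * \<beta>) < 1" using False C600 by simp
        show "t * a + (1 - 300 * \<beta>) * (1 - t) \<le> 1 / susceptibility N z"
        proof (cases "z = 0")
          case True
          then show ?thesis using \<beta> by (simp add: t_def susceptibility_0)
        next
          case z0: False
          have "(1 - 300 * \<beta>) * (susceptibility N u)\<^sup>2 \<le> gf_len N u origin" if "z \<le> u" "u \<le> zN" for u
          proof -
            have "(1 - 300 * \<beta>) * (susceptibility N u)\<^sup>2 \<le> (1 - bubble N u) * (susceptibility N u)\<^sup>2"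
              using d[of u] that z by (intro mult_right_mono) auto
            then show ?thesis using gf_len_bounds(2)[of u N] that z by simp
          qed
          then show ?thesis
            using inverse_susceptibility_ge[of z zN "1 - 300 * \<beta>" N] z0 z by (simp add: t_def a)
        qed
      qed (use \<beta> in simp)
      then show ?thesis using C600 \<beta> by (intro exI[of _ "2 * (300 * \<beta>)"]) simp
    qed
    show "1 / (inverse lam * real (vol N) powr (- 1 / 2) + 1 - z / critical_value N lam) \<le> susceptibility N z \<and>
      (\<exists>\<epsilon>. \<bar>\<epsilon>\<bar> \<le> C * (inverse (real N) + lam ^ 2) \<and> susceptibility N z \<le>
        (2 - z / critical_value N lam) /
        (inverse lam * real (vol N) powr (- 1 / 2) + (1 - \<epsilon>) * (1 - z / critical_value N lam)))"
      using lower upper unfolding t_def zN_def a_def \<beta>_def by blast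
  qed
qed

end
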